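(* Let $p,q\geq 2$ be coprime natural numbers and let $C$ be a simple closed curve on the spindle $\mathbb{CP}^1(p,q)$ that does not pass through the singular points. If $C$ divides $\mathbb{CP}^1(p,q)$ into two components, each containing one of the two singular points, then $C$ cannot be displaced from itself by an area preserving orbifold diffeomorphism; that is, there is no orbifold diffeomorphism $f:\mathbb{CP}^1(p,q)\to\mathbb{CP}^1(p,q)$ preserving the area form $\omega$ with $f(C)\cap C=\emptyset$.
   Context: Spindle. For coprime $p,q$, the spindle $\mathbb{CP}^1(p,q)=S^3/\!/S^1$ is the 2-dimensional orbifold whose underlying space is the quotient of the unit sphere $S^3\subseteq\mathbb{C}^2$ by the action $t\cdot(z_0,z_1)=(t^pz_0,t^qz_1)$ of $S^1\subseteq\mathbb{C}$; points are written $[z_0,z_1]$. Orbifold charts are given by slices to the orbits; explicitly, with $D=\{z\in\mathbb{C}:|z|<1\}$, a chart around $N=[0,1]$ is $D\to\mathbb{CP}^1(p,q)$, $z\mapsto[z,\sqrt{1-|z|^2}]$, with the group of $q$-th roots of unity acting by $z\mapsto\zeta^pz$, and a chart around $S=[1,0]$ is $z\mapsto[\sqrt{1-|z|^2},z]$ with the group of $p$-th roots of unity acting by $z\mapsto\zeta^qz$. These charts cover, and determine the orbifold structure. The points $N$ and $S$ are the only singular points (points with nontrivial isotropy), and their isotropy groups are cyclic of orders $q$ and $p$ respectively. Area form. The action is isometric for the standard Riemannian metric on $S^3$, so $\mathbb{CP}^1(p,q)$ inherits a Riemannian orbifold metric (in the charts: the metric for which the projection from $S^3$ is a Riemannian submersion),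 and $\omega$ is the associated area form, given in the charts by group-invariant nowhere vanishing 2-forms, for the orientation induced by the complex orientation of $D$. Maps. A smooth orbifold map $f:\mathcal{O}\to\mathcal{P}$ is a continuous map of underlying spaces such that for every $x$ there are orbifold charts $(\tilde U,\Gamma_U,\phi_U)$, $(\tilde V,\Gamma_V,\phi_V)$ (in the maximal atlases) around $x$ and $f(x)$, with images $U,V$, such that $f(U)\subseteq V$ and there is a smooth map $\tilde f:\tilde U\to\tilde V$ with $\phi_V\circ\tilde f=f\circ\phi_U$. An orbifold diffeomorphism is a smooth orbifold map having an inverse that is a smooth orbifold map. It is area preserving if its local lifts $\tilde f$ pull back the local expressions of $\omega$ to the local expressions of $\omega$. *)

theory Defs
  imports "HOL-Analysis.Analysis" "HOL-Algebra.Bij"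
begin

section \<open>Smooth maps between open sets\<close>

text \<open>
  In finite dimensions, \<open>f\<close> is of class \<open>C\<^sup>k\<^sup>+\<^sup>1\<close> on an open set iff it is differentiable there
  and all its directional derivatives are of class \<open>C\<^sup>k\<close>. Smoothness on \<open>complex\<close> is
  always meant in the real sense. These notions are only used on open sets.
\<close>

primrec Ck_on :: "nat \<Rightarrow> 'a::euclidean_space set \<Rightarrow> ('a \<Rightarrow> 'b::euclidean_space) \<Rightarrow> bool" where
  "Ck_on 0 S f \<longleftrightarrow> continuous_on S f"
| "Ck_on (Suc k) S f \<longleftrightarrow>
     (\<forall>x\<in>S. f differentiable (at x)) \<and> (\<forall>v. Ck_on k S (\<lambda>x. frechet_derivative f (at x) v))"

definition smooth_on :: "'a::euclidean_space set \<Rightarrow> ('a \<Rightarrow> 'b::euclidean_space) \<Rightarrow> bool" where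
  "smooth_on S f \<longleftrightarrow> (\<forall>k. Ck_on k S f)"

definition diffeomorphism_on ::
  "'a::euclidean_space set \<Rightarrow> 'b::euclidean_space set \<Rightarrow> ('a \<Rightarrow> 'b) \<Rightarrow> bool" where
  "diffeomorphism_on S T h \<longleftrightarrow> open S \<and> open T \<and> smooth_on S h \<and>
     (\<exists>g. smooth_on T g \<and> homeomorphism S T h g)"


section \<open>Two-dimensional effective orbifolds\<close>

text \<open>
  Charts \<open>(U, \<Gamma>, \<phi>)\<close> have a connected open set of the plane as domain. The group is a finite
  group of diffeomorphisms of \<open>U\<close>, given as a subgroup of the group of all bijections of \<open>U\<close>
  (functions that are \<open>undefined\<close> outside \<open>U\<close>), so it acts effectively.
\<close>

record 'a orb_chart =
  cdom :: "complex set"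
  cgrp :: "(complex \<Rightarrow> complex) set"
  cmap :: "complex \<Rightarrow> 'a"

abbreviation cimage :: "'a orb_chart \<Rightarrow> 'a set" where
  "cimage c \<equiv> cmap c ` cdom c"

text \<open>The last three conditions say that \<open>\<phi>\<close> induces a homeomorphism from \<open>U/\<Gamma>\<close> onto an open set.\<close>

definition orbifold_chart :: "'a topology \<Rightarrow> 'a orb_chart \<Rightarrow> bool" where
  "orbifold_chart X c \<longleftrightarrow>
     open (cdom c) \<and> connected (cdom c) \<and>
     finite (cgrp c) \<and> subgroup (cgrp c) (BijGroup (cdom c)) \<and>
     (\<forall>g\<in>cgrp c. smooth_on (cdom c) g) \<and>
     openin X (cimage c) \<and>
     quotient_map (top_of_set (cdom c)) (subtopology X (cimage c)) (cmap c) \<and>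
     (\<forall>x\<in>cdom c. \<forall>y\<in>cdom c. cmap c x = cmap c y \<longleftrightarrow> (\<exists>g\<in>cgrp c. y = g x))"

definition chart_change ::
  "'a orb_chart \<Rightarrow> 'a orb_chart \<Rightarrow> complex set \<Rightarrow> (complex \<Rightarrow> complex) \<Rightarrow> bool" where
  "chart_change c d W h \<longleftrightarrow>
     W \<subseteq> cdom c \<and> h ` W \<subseteq> cdom d \<and> diffeomorphism_on W (h ` W) h \<and>
     (\<forall>z\<in>W. cmap d (h z) = cmap c z)"

definition charts_compatible :: "'a orb_chart \<Rightarrow> 'a orb_chart \<Rightarrow> bool" where
  "charts_compatible c d \<longleftrightarrow>
     (\<forall>x\<in>cdom c. \<forall>y\<in>cdom d. cmap c x = cmap d y \<longrightarrow>
        (\<exists>W h. x \<in> W \<and> chart_change c d W h \<and> h x = y))"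

text \<open>The maximal atlas generated by an atlas \<open>A\<close> on the space \<open>X\<close>.\<close>

definition maximal_atlas :: "'a topology \<Rightarrow> 'a orb_chart set \<Rightarrow> 'a orb_chart set" where
  "maximal_atlas X A = {c. orbifold_chart X c \<and> (\<forall>d\<in>A. charts_compatible c d)}"

text \<open>Points with nontrivial isotropy; the isotropy group does not depend on the chart, up to
  isomorphism.\<close>

definition singular_points :: "'a topology \<Rightarrow> 'a orb_chart set \<Rightarrow> 'a set" where
  "singular_points X A =
     {x. \<exists>c\<in>maximal_atlas X A. \<exists>z\<in>cdom c. cmap c z = x \<and>
           {g \<in> cgrp c. g z = z} \<noteq> {\<one>\<^bsub>BijGroup (cdom c)\<^esub>}}"

definition local_lift ::
  "('a \<Rightarrow> 'b) \<Rightarrow> 'a orb_chart \<Rightarrow> 'b orb_chart \<Rightarrow> (complex \<Rightarrow> complex) \<Rightarrow> bool" where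
  "local_lift f c d g \<longleftrightarrow>
     f ` cimage c \<subseteq> cimage d \<and> smooth_on (cdom c) g \<and> g ` cdom c \<subseteq> cdom d \<and>
     (\<forall>z\<in>cdom c. cmap d (g z) = f (cmap c z))"

definition smooth_orbifold_map ::
  "'a topology \<Rightarrow> 'a orb_chart set \<Rightarrow> 'b topology \<Rightarrow> 'b orb_chart set \<Rightarrow> ('a \<Rightarrow> 'b) \<Rightarrow> bool" where
  "smooth_orbifold_map X A Y B f \<longleftrightarrow>
     continuous_map X Y f \<and>
     (\<forall>x\<in>topspace X. \<exists>c\<in>maximal_atlas X A. \<exists>d\<in>maximal_atlas Y B.
        x \<in> cimage c \<and> f x \<in> cimage d \<and> (\<exists>g. local_lift f c d g))"

definition orbifold_diffeomorphism ::
  "'a topology \<Rightarrow> 'a orb_chart set \<Rightarrow> 'b topology \<Rightarrow> 'b orb_chart set \<Rightarrow> ('a \<Rightarrow> 'b) \<Rightarrow> bool" where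
  "orbifold_diffeomorphism X A Y B f \<longleftrightarrow>
     smooth_orbifold_map X A Y B f \<and>
     (\<exists>g. smooth_orbifold_map Y B X A g \<and>
          (\<forall>x\<in>topspace X. g (f x) = x) \<and> (\<forall>y\<in>topspace Y. f (g y) = y))"


section \<open>The spindle\<close>

definition orbit :: "nat \<Rightarrow> nat \<Rightarrow> complex \<times> complex \<Rightarrow> (complex \<times> complex) set" where
  "orbit p q z = {(t ^ p * fst z, t ^ q * snd z) | t. cmod t = 1}"

definition spindle :: "nat \<Rightarrow> nat \<Rightarrow> (complex \<times> complex) set topology" where
  "spindle p q = topology (\<lambda>U. U \<subseteq> orbit p q ` sphere 0 1 \<and>
     openin (top_of_set (sphere 0 1)) {z \<in> sphere 0 1. orbit p q z \<in> U})"

lemma openin_spindle: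
  "openin (spindle p q) U \<longleftrightarrow> U \<subseteq> orbit p q ` sphere 0 1 \<and>
     openin (top_of_set (sphere 0 1)) {z \<in> sphere 0 1. orbit p q z \<in> U}"
proof -
  let ?S = "sphere (0 :: complex \<times> complex) 1"
  let ?P = "\<lambda>U. U \<subseteq> orbit p q ` ?S \<and> openin (top_of_set ?S) {z \<in> ?S. orbit p q z \<in> U}"
  have "?P (U \<inter> V)" if "?P U" "?P V" for U V
  proof -
    have "{z \<in> ?S. orbit p q z \<in> U \<inter> V} =
            {z \<in> ?S. orbit p q z \<in> U} \<inter> {z \<in> ?S. orbit p q z \<in> V}"
      by blast
    with that show ?thesis
      by (auto simp only: openin_Int)
  qed
  moreover have "?P (\<Union>K)" if "\<forall>U\<in>K. ?P U" for K
  proof -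
    have "{z \<in> ?S. orbit p q z \<in> \<Union>K} = (\<Union>U\<in>K. {z \<in> ?S. orbit p q z \<in> U})"
      by blast
    moreover have "openin (top_of_set ?S) \<dots>"
      using that by (intro openin_Union) blast
    ultimately show ?thesis
      using that by (simp only:) blast
  qed
  ultimately have "istopology ?P"
    unfolding istopology_def by blast
  then show ?thesis
    unfolding spindle_def by (simp add: topology_inverse')
qed

lemma topspace_spindle: "topspace (spindle p q) = orbit p q ` sphere 0 1"
proof
  show "topspace (spindle p q) \<subseteq> orbit p q ` sphere 0 1"
    using openin_spindle openin_topspace by blast
  have "{z \<in> sphere 0 1. orbit p q z \<in> orbit p q ` sphere 0 1} = sphere 0 1"
    by blast
  then have "openin (spindle p q) (orbit p q ` sphere 0 1)"
    unfolding openin_spindle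
    by (metis (mono_tags, lifting) openin_subtopology_self order_refl)
  then show "orbit p q ` sphere 0 1 \<subseteq> topspace (spindle p q)"
    by (rule openin_subset)
qed

lemma quotient_map_orbit:
  "quotient_map (top_of_set (sphere 0 1)) (spindle p q) (orbit p q)"
  unfolding quotient_map_def by (simp add: topspace_spindle openin_spindle)

text \<open>The slices through \<open>(0, 1)\<close> and \<open>(1, 0)\<close>, and the charts around \<open>N\<close> and \<open>S\<close> they induce.\<close>

definition slice_N :: "complex \<Rightarrow> complex \<times> complex" where
  "slice_N z = (z, complex_of_real (sqrt (1 - (cmod z)\<^sup>2)))"

definition slice_S :: "complex \<Rightarrow> complex \<times> complex" where
  "slice_S z = (complex_of_real (sqrt (1 - (cmod z)\<^sup>2)), z)"

definition chart_N :: "nat \<Rightarrow> nat \<Rightarrow> (complex \<times> complex) set orb_chart" where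
  "chart_N p q = \<lparr> cdom = ball 0 1,
     cgrp = {(\<lambda>z\<in>ball 0 1. \<zeta> ^ p * z) | \<zeta>. \<zeta> ^ q = 1},
     cmap = (\<lambda>z. orbit p q (slice_N z)) \<rparr>"

definition chart_S :: "nat \<Rightarrow> nat \<Rightarrow> (complex \<times> complex) set orb_chart" where
  "chart_S p q = \<lparr> cdom = ball 0 1,
     cgrp = {(\<lambda>z\<in>ball 0 1. \<zeta> ^ q * z) | \<zeta>. \<zeta> ^ p = 1},
     cmap = (\<lambda>z. orbit p q (slice_S z)) \<rparr>"

definition spindle_atlas :: "nat \<Rightarrow> nat \<Rightarrow> (complex \<times> complex) set orb_chart set" where
  "spindle_atlas p q = {chart_N p q, chart_S p q}"


section \<open>The area form\<close>

text \<open>A 2-form on an open set of the plane is a function \<open>z v w \<mapsto> \<omega>\<^sub>z(v, w)\<close>.\<close>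

type_synonym two_form = "complex \<Rightarrow> complex \<Rightarrow> complex \<Rightarrow> real"

definition pullback_form :: "(complex \<Rightarrow> complex) \<Rightarrow> two_form \<Rightarrow> two_form" where
  "pullback_form h \<omega> x v w =
     \<omega> (h x) (frechet_derivative h (at x) v) (frechet_derivative h (at x) w)"

text \<open>The oriented area form of a metric \<open>g\<close>: the square root of its Gram determinant in the
  basis \<open>1, \<i>\<close>, times \<open>dx \<and> dy\<close>.\<close>

definition metric_area_form :: "(complex \<Rightarrow> complex \<Rightarrow> complex \<Rightarrow> real) \<Rightarrow> two_form" where
  "metric_area_form g z v w =
     sqrt (g z 1 1 * g z \<i> \<i> - (g z 1 \<i>)\<^sup>2) * (Re v * Im w - Im v * Re w)"

text \<open>Derivative of \<open>t \<cdot> x\<close> at \<open>t = 1\<close> along the circle; it spans the tangent line of the orbit.\<close>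

definition orbit_direction :: "nat \<Rightarrow> nat \<Rightarrow> complex \<times> complex \<Rightarrow> complex \<times> complex" where
  "orbit_direction p q x = (\<i> * of_nat p * fst x, \<i> * of_nat q * snd x)"

definition horizontal_part ::
  "nat \<Rightarrow> nat \<Rightarrow> complex \<times> complex \<Rightarrow> complex \<times> complex \<Rightarrow> complex \<times> complex" where
  "horizontal_part p q x u = (let \<xi> = orbit_direction p q x in u - ((u \<bullet> \<xi>) / (\<xi> \<bullet> \<xi>)) *\<^sub>R \<xi>)"

text \<open>
  Let \<open>s\<close> be a smooth local lift to the sphere of a chart map. The projection sends \<open>ds(v)\<close> to \<open>v\<close>,
  so the horizontal lift of \<open>v\<close> to \<open>s(z)\<close> is the horizontal part of \<open>ds(v)\<close>, and the metric making
  the projection a Riemannian submersion is the following one.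
\<close>

definition submersion_metric ::
  "nat \<Rightarrow> nat \<Rightarrow> (complex \<Rightarrow> complex \<times> complex) \<Rightarrow> complex \<Rightarrow> complex \<Rightarrow> complex \<Rightarrow> real" where
  "submersion_metric p q s z v w =
     horizontal_part p q (s z) (frechet_derivative s (at z) v) \<bullet>
     horizontal_part p q (s z) (frechet_derivative s (at z) w)"

text \<open>
  \<open>area_form_at p q c x \<eta>\<close>: the value at \<open>x\<close> of the local expression of the area form in the chart
  \<open>c\<close> of the maximal atlas is \<open>\<eta>\<close>. In \<open>chart_N\<close> and \<open>chart_S\<close> the expression is the area form of the
  submersion metric for the complex orientation of the disc; elsewhere it is obtained by changing
  charts. The value does not depend on the chart change, because the groups of the two charts act
  by orientation preserving isometries, and so do the changes between them.
\<close>

definition area_form_at ::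
  "nat \<Rightarrow> nat \<Rightarrow> (complex \<times> complex) set orb_chart \<Rightarrow> complex \<Rightarrow> (complex \<Rightarrow> complex \<Rightarrow> real) \<Rightarrow> bool"
  where
  "area_form_at p q c x \<eta> \<longleftrightarrow>
     (\<exists>(b, s) \<in> {(chart_N p q, slice_N), (chart_S p q, slice_S)}. \<exists>W h.
        x \<in> W \<and> chart_change c b W h \<and>
        \<eta> = pullback_form h (metric_area_form (submersion_metric p q s)) x)"

definition area_preserving ::
  "nat \<Rightarrow> nat \<Rightarrow> ((complex \<times> complex) set \<Rightarrow> (complex \<times> complex) set) \<Rightarrow> bool" where
  "area_preserving p q f \<longleftrightarrow>
     (\<forall>c \<in> maximal_atlas (spindle p q) (spindle_atlas p q).
      \<forall>d \<in> maximal_atlas (spindle p q) (spindle_atlas p q).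
      \<forall>g. local_lift f c d g \<longrightarrow>
        (\<forall>x\<in>cdom c. \<forall>\<eta> \<theta>. area_form_at p q c x \<eta> \<longrightarrow> area_form_at p q d (g x) \<theta> \<longrightarrow>
           pullback_form g (\<lambda>_. \<theta>) x = \<eta>))"


section \<open>Simple closed curves\<close>

definition simple_closed_curve :: "'a topology \<Rightarrow> 'a set \<Rightarrow> bool" where
  "simple_closed_curve X C \<longleftrightarrow>
     (\<exists>c. pathin X c \<and> c 0 = c 1 \<and> inj_on c {0..<1} \<and> C = c ` {0..1})"

end

theory Submission
  imports Defs
begin

text \<open>
  Let \<open>N\<close> and \<open>S\<close> be the two cone points, of orders \<open>q\<close> and \<open>p\<close>. An area preserving orbifold
  diffeomorphism \<open>f\<close> fixes both of them, because \<open>p \<noteq> q\<close>. Hence, if \<open>f(C)\<close> were disjoint from \<open>C\<close>, it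
  would lie in one of the two sides of \<open>C\<close>, and \<open>f\<close> would map the side \<open>B\<close> of \<open>C\<close> that contains \<open>S\<close>
  strictly over itself or strictly into itself, the difference containing a nonempty open set
  (\<open>displaced_separator_nested\<close>). This contradicts the preservation of area.

  Three ingredients make this rigorous. First, the lift of \<open>f\<close> to the cone charts: near any point,
  \<open>f\<close> is covered by a map \<open>H\<close> between discs whose derivative multiplies the area density by the
  expected factor (\<open>area_preserving_lift\<close>); in particular that derivative is invertible.

  Second, the cone points. If \<open>f\<close> maps a cone point of order \<open>m\<close> to a point whose isotropy group has
  order \<open>m'\<close>, then the derivative \<open>L\<close> of the lift maps the \<open>m\<close> points \<open>\<zeta>\<close> with \<open>\<zeta>\<^sup>m = 1\<close> injectively
  into the isotropy orbit of \<open>L 1\<close>, so that \<open>m \<le> m'\<close> (\<open>isotropy_order_le\<close>). A cone point therefore goes to a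
  cone point, and exchanging the two would give \<open>p = q\<close>. The same atlas yields that no point other
  than \<open>N\<close> and \<open>S\<close> is singular (\<open>singular_points_subset\<close>), so that the two sides of \<open>C\<close> do contain
  \<open>N\<close> and \<open>S\<close>.

  Third, the area of an open set of the spindle. The quotient of the chart around \<open>N\<close> by rotations is
  again a disc, with coordinate \<open>u = z\<^sup>q\<close>. In this coordinate \<open>f\<close> is one globally defined injective
  differentiable map of the punctured disc, and the change of variables formula applies to it directly
  (\<open>coord_map_derivative\<close>, \<open>invariant_density_integral\<close>), so no fundamental domains or local pieces have
  to be counted. The density of the area in the coordinate \<open>u\<close> blows up at \<open>0\<close>; only the side \<open>B\<close> away
  from \<open>N\<close> and its image are measured, and there it is bounded (\<open>area_obstruction\<close>).
\<close>

section \<open>The area form in the two cone charts\<close>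

definition signed_area :: "complex \<Rightarrow> complex \<Rightarrow> real" where
  "signed_area v w = Re v * Im w - Im v * Re w"

definition jacobian :: "(complex \<Rightarrow> complex) \<Rightarrow> real" where
  "jacobian L = signed_area (L 1) (L \<i>)"

lemma linear_complex_expand:
  assumes "linear (L :: complex \<Rightarrow> complex)"
  shows "L v = Re v *\<^sub>R L 1 + Im v *\<^sub>R L \<i>"
proof -
  have "v = Re v *\<^sub>R 1 + Im v *\<^sub>R \<i>"
    by (simp add: complex_eq_iff)
  then have "L v = L (Re v *\<^sub>R 1 + Im v *\<^sub>R \<i>)"
    by (rule arg_cong[of _ _ L])
  also have "\<dots> = Re v *\<^sub>R L 1 + Im v *\<^sub>R L \<i>"
    using assms by (simp only: linear_add linear_scale)
  finally show ?thesis .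
qed

lemma signed_area_linear:
  assumes "linear L"
  shows "signed_area (L v) (L w) = jacobian L * signed_area v w"
  unfolding linear_complex_expand[OF assms, of v] linear_complex_expand[OF assms, of w]
  by (simp add: signed_area_def jacobian_def algebra_simps)

lemma jacobian_compose:
  assumes "linear L"
  shows "jacobian (L \<circ> M) = jacobian L * jacobian M"
  unfolding jacobian_def[of "L \<circ> M"] jacobian_def[of M] o_apply by (rule signed_area_linear[OF assms])

lemma jacobian_mult: "jacobian (\<lambda>v. a * v) = (cmod a)\<^sup>2"
  by (simp add: jacobian_def signed_area_def cmod_power2) (simp add: power2_eq_square)

text \<open>
  The function that multiplies the Euclidean area form of the disc in \<open>chart_N\<close>. The orbit direction
  at the point \<open>(z, s)\<close> of the slice, where \<open>s\<^sup>2 = 1 - \<bar>z\<bar>\<^sup>2\<close>, has squared length \<open>p\<^sup>2 \<bar>z\<bar>\<^sup>2 + q\<^sup>2 s\<^sup>2\<close>.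
\<close>

definition area_density :: "nat \<Rightarrow> nat \<Rightarrow> complex \<Rightarrow> real" where
  "area_density p q z = real q / sqrt ((real p)\<^sup>2 * (cmod z)\<^sup>2 + (real q)\<^sup>2 * (1 - (cmod z)\<^sup>2))"

lemma slice_N_has_derivative:
  assumes "cmod z < 1"
  shows "(slice_N has_derivative
           (\<lambda>v. (v, complex_of_real (- (z \<bullet> v) / sqrt (1 - (cmod z)\<^sup>2))))) (at z)"
proof -
  have pos: "1 - z \<bullet> z > 0"
    using assms by (simp add: dot_square_norm abs_square_less_1)
  have "((\<lambda>z. complex_of_real (sqrt (1 - z \<bullet> z))) has_derivative
          (\<lambda>v. complex_of_real (- (z \<bullet> v) / sqrt (1 - z \<bullet> z)))) (at z)"
    using pos
    by (auto intro!: derivative_eq_intros ext simp: inner_commute field_simps)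
  then show ?thesis
    unfolding slice_N_def dot_square_norm[symmetric]
    by (intro has_derivative_Pair has_derivative_ident)
qed

text \<open>
  The second component \<open>s\<close> of the slice is real, so its derivative is orthogonal to the orbit direction.
  Hence the horizontal metric is the Euclidean one, plus the square of the derivative of \<open>s\<close>, minus the
  square of the component of the first factor along the orbit. Its Gram determinant factors into the effects of these two corrections,
  \<open>1 + r\<^sup>2/s\<^sup>2 = 1/s\<^sup>2\<close> and \<open>1 - p\<^sup>2r\<^sup>2/n = q\<^sup>2s\<^sup>2/n\<close>, because they act in the orthogonal directions
  \<open>z\<close> and \<open>\<i> z\<close>.
\<close>

lemma submersion_area_slice_N:
  assumes z: "cmod z < 1" and q: "q > 0"
  shows "metric_area_form (submersion_metric p q slice_N) z v w = area_density p q z * signed_area v w"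
proof -
  obtain x y where zxy: "z = Complex x y" by (cases z)
  define s where "s = sqrt (1 - (cmod z)\<^sup>2)"
  define n where "n = (real p)\<^sup>2 * (cmod z)\<^sup>2 + (real q)\<^sup>2 * (1 - (cmod z)\<^sup>2)"
  have s2: "s\<^sup>2 = 1 - (x\<^sup>2 + y\<^sup>2)" and s0: "s > 0"
    using z abs_square_less_1[of "cmod z"] by (auto simp: s_def zxy cmod_power2 real_sqrt_pow2)
  have n: "n = (real p)\<^sup>2 * (x\<^sup>2 + y\<^sup>2) + (real q)\<^sup>2 * s\<^sup>2"
    unfolding n_def s2 by (simp add: zxy cmod_power2)
  have n0: "n > 0"
    unfolding n using s0 q by (intro add_nonneg_pos mult_pos_pos mult_nonneg_nonneg) auto
  define \<xi> where "\<xi> = orbit_direction p q (slice_N z)"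
  have \<xi>: "\<xi> = (\<i> * of_nat p * Complex x y, \<i> * of_nat q * complex_of_real s)"
    by (simp add: \<xi>_def orbit_direction_def slice_N_def s_def zxy)
  have \<xi>\<xi>: "\<xi> \<bullet> \<xi> = n"
    unfolding n \<xi> by (simp add: inner_complex_def) (simp add: power2_eq_square algebra_simps)
  have D: "frechet_derivative slice_N (at z) v = (v, complex_of_real (- (z \<bullet> v) / s))" for v
    using frechet_derivative_at[OF slice_N_has_derivative[OF z], THEN fun_cong, of v]
    by (simp add: s_def)
  have inner_horizontal: "horizontal_part p q (slice_N z) a \<bullet> horizontal_part p q (slice_N z) b =
      a \<bullet> b - (a \<bullet> \<xi>) * (b \<bullet> \<xi>) / n" for a b
    using n0 unfolding horizontal_part_def \<xi>_def[symmetric] Let_def \<xi>\<xi>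
    by (simp add: inner_diff_left inner_diff_right \<xi>\<xi> inner_commute field_simps)
  have g: "submersion_metric p q slice_N z v w =
      v \<bullet> w + (z \<bullet> v) * (z \<bullet> w) / s\<^sup>2 - (real p)\<^sup>2 * (v \<bullet> (\<i> * z)) * (w \<bullet> (\<i> * z)) / n" for v w
    unfolding submersion_metric_def D inner_horizontal unfolding \<xi> zxy
    by (simp add: inner_complex_def power2_eq_square algebra_simps)
  have "submersion_metric p q slice_N z 1 1 * submersion_metric p q slice_N z \<i> \<i>
          - (submersion_metric p q slice_N z 1 \<i>)\<^sup>2
      = (1 + x\<^sup>2 / s\<^sup>2 - (real p)\<^sup>2 * y\<^sup>2 / n) * (1 + y\<^sup>2 / s\<^sup>2 - (real p)\<^sup>2 * x\<^sup>2 / n)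
          - (x * y / s\<^sup>2 + (real p)\<^sup>2 * x * y / n)\<^sup>2"
    unfolding g unfolding zxy by (simp add: inner_complex_def power2_eq_square algebra_simps)
  also have "\<dots> = (1 + (x\<^sup>2 + y\<^sup>2) / s\<^sup>2) * (1 - (real p)\<^sup>2 * (x\<^sup>2 + y\<^sup>2) / n)"
    unfolding divide_inverse by algebra
  also have "1 + (x\<^sup>2 + y\<^sup>2) / s\<^sup>2 = 1 / s\<^sup>2"
  proof -
    have "x\<^sup>2 + y\<^sup>2 = 1 - s\<^sup>2" by (simp add: s2)
    then show ?thesis using s0 by (simp add: field_simps)
  qed
  also have "1 - (real p)\<^sup>2 * (x\<^sup>2 + y\<^sup>2) / n = (real q)\<^sup>2 * s\<^sup>2 / n"
    using n0 by (simp add: field_simps n)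
  also have "1 / s\<^sup>2 * ((real q)\<^sup>2 * s\<^sup>2 / n) = (real q)\<^sup>2 / n"
    using s0 by simp
  finally show ?thesis
    unfolding metric_area_form_def signed_area_def area_density_def n_def[symmetric]
    by (simp add: real_sqrt_divide)
qed

text \<open>
  Exchanging the two coordinates of \<open>\<complex>\<^sup>2\<close> is an isometry that exchanges the weights. Everything about
  \<open>chart_S\<close> is reduced to \<open>chart_N\<close> in this way.
\<close>

lemma slice_S_swap: "slice_S z = prod.swap (slice_N z)"
  by (simp add: slice_S_def slice_N_def)

lemma submersion_metric_slice_S:
  assumes "cmod z < 1"
  shows "submersion_metric p q slice_S z v w = submersion_metric q p slice_N z v w"
proof -
  have "(slice_N has_derivative frechet_derivative slice_N (at z)) (at z)"
    using differentiableI[OF slice_N_has_derivative[OF assms]]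
    by (simp only: frechet_derivative_works)
  then have "((\<lambda>z. prod.swap (slice_N z)) has_derivative
      (\<lambda>v. prod.swap (frechet_derivative slice_N (at z) v))) (at z)"
    unfolding prod.swap_def
    by (intro has_derivative_Pair has_derivative_fst has_derivative_snd)
  then have "(slice_S has_derivative (\<lambda>v. prod.swap (frechet_derivative slice_N (at z) v))) (at z)"
    unfolding slice_S_swap[abs_def] .
  note deriv_S = frechet_derivative_at[OF this]
  have D: "frechet_derivative slice_S (at z) v = prod.swap (frechet_derivative slice_N (at z) v)" for v
    by (simp add: deriv_S[symmetric])
  have sw: "prod.swap a \<bullet> prod.swap b = a \<bullet> b" for a b :: "complex \<times> complex"
    by (cases a; cases b) (simp add: add.commute)
  have o: "orbit_direction p q (prod.swap x) = prod.swap (orbit_direction q p x)" for x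
    by (simp add: orbit_direction_def)
  have "horizontal_part p q (prod.swap x) (prod.swap u) = prod.swap (horizontal_part q p x u)" for x u
    unfolding horizontal_part_def Let_def o sw by (simp add: prod_eq_iff)
  then show ?thesis
    unfolding submersion_metric_def D by (simp only: slice_S_swap sw)
qed

lemma submersion_area_slice_S:
  assumes "cmod z < 1" "p > 0"
  shows "metric_area_form (submersion_metric p q slice_S) z v w = area_density q p z * signed_area v w"
proof -
  have "metric_area_form (submersion_metric p q slice_S) z v w =
      metric_area_form (submersion_metric q p slice_N) z v w"
    unfolding metric_area_form_def submersion_metric_slice_S[OF assms(1)] ..
  also have "\<dots> = area_density q p z * signed_area v w"
    by (rule submersion_area_slice_N[OF assms])
  finally show ?thesis .
qed

lemma area_density_radicand_pos:
  assumes "cmod z \<le> 1" "p > 0" "q > 0"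
  shows "(real p)\<^sup>2 * (cmod z)\<^sup>2 + (real q)\<^sup>2 * (1 - (cmod z)\<^sup>2) > 0"
proof (cases "cmod z = 1")
  case False
  then have "(cmod z)\<^sup>2 < 1"
    using assms(1) by (simp add: abs_square_less_1)
  then show ?thesis
    using assms by (intro add_nonneg_pos mult_pos_pos) auto
qed (use assms in auto)

lemma area_density_pos:
  assumes "cmod z \<le> 1" "p > 0" "q > 0"
  shows "area_density p q z > 0"
  using area_density_radicand_pos[OF assms] assms(3) by (simp add: area_density_def)

section \<open>Orbits, slices and the topology of the spindle\<close>

lemma root_of_unity_power_root:
  assumes "coprime p q" "p > 0" and "(\<zeta> :: complex) ^ q = 1"
  obtains t where "t ^ q = 1" "t ^ p = \<zeta>"
proof -
  obtain x y where "p * x = q * y + gcd p q"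
    using bezout_nat[of p q] assms(2) by auto
  then have "(\<zeta> ^ x) ^ p = \<zeta>"
    using assms by (simp add: power_mult[symmetric] mult.commute[of x p] power_add) (simp add: power_mult)
  moreover have "(\<zeta> ^ x) ^ q = 1"
    using assms(3) by (metis mult.commute power_mult power_one)
  ultimately show ?thesis using that by blast
qed

text \<open>
  The torus point \<open>(a, b)\<close> lies on the torus knot \<open>a\<^sup>q = b\<^sup>p\<close>, which is parametrized by \<open>t \<mapsto> (t\<^sup>p, t\<^sup>q)\<close>; a
  Bezout identity \<open>p x = q y + 1\<close> gives the parameter \<open>a\<^sup>x / b\<^sup>y\<close>.
\<close>

lemma common_power_root:
  assumes "coprime p q" "p > 0" and "(a :: complex) ^ q = b ^ p" "cmod a = 1" "cmod b = 1"
  obtains t where "cmod t = 1" "t ^ p = a" "t ^ q = b"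
proof -
  obtain x y where xy: "p * x = q * y + 1"
    using bezout_nat[of p q] assms(1,2) by auto
  have nz: "a \<noteq> 0" "b \<noteq> 0" using assms by auto
  have "(a ^ x / b ^ y) ^ p = a ^ (p * x) / (b ^ p) ^ y"
    by (simp add: power_divide power_mult[symmetric] mult.commute)
  also have "\<dots> = a"
    using nz by (simp add: xy assms(3)[symmetric] power_mult[symmetric] power_add)
  finally have 1: "(a ^ x / b ^ y) ^ p = a" .
  have "(a ^ x / b ^ y) ^ q = (a ^ q) ^ x / b ^ (q * y)"
    by (simp add: power_divide power_mult[symmetric] mult.commute)
  also have "\<dots> = b ^ (p * x) / b ^ (q * y)"
    by (simp add: assms(3) power_mult[symmetric])
  also have "\<dots> = b"
    using nz by (simp add: xy power_add)
  finally have 2: "(a ^ x / b ^ y) ^ q = b" .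
  have "cmod (a ^ x / b ^ y) = 1"
    using assms by (simp add: norm_divide norm_power)
  with 1 2 show ?thesis using that by blast
qed

lemma norm_1_if_power_1:
  assumes "n > 0" "cmod t ^ n = 1"
  shows "cmod t = 1"
  using power_eq_imp_eq_base[of "cmod t" n 1] assms by simp

lemma rotate_to_positive:
  assumes "n > 0" and "w \<noteq> 0"
  obtains t where "cmod t = 1" "t ^ n * w = complex_of_real (cmod w)"
proof -
  obtain t where t: "complex_of_real (cmod w) / w = t ^ n"
    using exists_complex_root[of n] assms(1) by blast
  then have "cmod t ^ n = 1"
    using assms by (metis divide_self_if norm_divide norm_eq_zero norm_of_real norm_power abs_norm_cancel)
  then have "cmod t = 1"
    using assms(1) by (rule norm_1_if_power_1[rotated])
  then show ?thesis
    using that[of t] assms by (simp add: t[symmetric])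
qed

lemma orbit_eq_iff:
  "orbit p q z = orbit p q w \<longleftrightarrow> (\<exists>t. cmod t = 1 \<and> w = (t ^ p * fst z, t ^ q * snd z))"
proof
  assume "orbit p q z = orbit p q w"
  moreover have "w \<in> orbit p q w"
    by (auto simp: orbit_def intro!: exI[of _ 1])
  ultimately show "\<exists>t. cmod t = 1 \<and> w = (t ^ p * fst z, t ^ q * snd z)"
    by (auto simp: orbit_def)
next
  assume "\<exists>t. cmod t = 1 \<and> w = (t ^ p * fst z, t ^ q * snd z)"
  then obtain t where t: "cmod t = 1" and w: "w = (t ^ p * fst z, t ^ q * snd z)" by blast
  have t0: "t \<noteq> 0" using t by auto
  have "\<exists>r. cmod r = 1 \<and> (s ^ p * fst z, s ^ q * snd z) = (r ^ p * fst w, r ^ q * snd w)"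
    if "cmod s = 1" for s
    using that t t0 by (intro exI[of _ "s / t"]) (simp add: w norm_divide power_divide)
  moreover have "\<exists>r. cmod r = 1 \<and> (s ^ p * fst w, s ^ q * snd w) = (r ^ p * fst z, r ^ q * snd z)"
    if "cmod s = 1" for s
    using that t by (intro exI[of _ "s * t"]) (simp add: w norm_mult power_mult_distrib)
  ultimately show "orbit p q z = orbit p q w"
    unfolding orbit_def by blast
qed

lemma orbit_swap: "orbit p q (prod.swap z) = prod.swap ` orbit q p z"
  by (force simp: orbit_def)

lemma orbit_swap_eq_iff:
  "orbit p q (prod.swap z) = orbit p q (prod.swap w) \<longleftrightarrow> orbit q p z = orbit q p w"
  unfolding orbit_swap by (simp add: inj_image_eq_iff)

text \<open>
  An orbit through the slice returns to it exactly at the elements \<open>t\<close> fixing the positive second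
  coordinate, the \<open>q\<close>-th roots of unity. As \<open>p\<close> is coprime to \<open>q\<close>, their \<open>p\<close>-th powers are again all
  \<open>q\<close>-th roots of unity.
\<close>

lemma orbit_slice_N_eq_iff:
  assumes "coprime p q" "p > 0" "q > 0" "cmod z < 1" "cmod w < 1"
  shows "orbit p q (slice_N z) = orbit p q (slice_N w) \<longleftrightarrow> (\<exists>\<zeta>. \<zeta> ^ q = 1 \<and> w = \<zeta> * z)"
proof
  assume "orbit p q (slice_N z) = orbit p q (slice_N w)"
  then obtain t where t: "cmod t = 1" and w: "w = t ^ p * z"
    and s: "complex_of_real (sqrt (1 - (cmod w)\<^sup>2)) = t ^ q * complex_of_real (sqrt (1 - (cmod z)\<^sup>2))"
    unfolding orbit_eq_iff slice_N_def by auto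
  have "cmod w = cmod z"
    using t by (simp add: w norm_mult norm_power)
  moreover have "sqrt (1 - (cmod z)\<^sup>2) \<noteq> 0"
    using assms(4) abs_square_less_1[of "cmod z"] by simp
  ultimately have "t ^ q = 1" using s by simp
  then have "(t ^ p) ^ q = 1"
    by (metis mult.commute power_mult power_one)
  with w show "\<exists>\<zeta>. \<zeta> ^ q = 1 \<and> w = \<zeta> * z" by blast
next
  assume "\<exists>\<zeta>. \<zeta> ^ q = 1 \<and> w = \<zeta> * z"
  then obtain \<zeta> where \<zeta>: "\<zeta> ^ q = 1" and w: "w = \<zeta> * z" by blast
  obtain t where t: "t ^ q = 1" "t ^ p = \<zeta>"
    using root_of_unity_power_root[OF assms(1,2) \<zeta>] .
  have "cmod t ^ q = 1"
    using t(1) by (metis norm_one norm_power)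
  then have "cmod t = 1"
    using assms(3) by (rule norm_1_if_power_1[rotated])
  moreover from this have "cmod w = cmod z"
    using t by (simp add: w norm_mult t(2)[symmetric] norm_power)
  ultimately show "orbit p q (slice_N z) = orbit p q (slice_N w)"
    unfolding orbit_eq_iff slice_N_def using t by (auto simp: w)
qed

lemma sphere_pair_iff: "z \<in> sphere (0 :: complex \<times> complex) 1 \<longleftrightarrow> (cmod (fst z))\<^sup>2 + (cmod (snd z))\<^sup>2 = 1"
  by (simp add: norm_prod_def)

lemma slice_N_in_sphere: "cmod z < 1 \<Longrightarrow> slice_N z \<in> sphere 0 1"
  using abs_square_less_1[of "cmod z"] by (simp only: sphere_pair_iff) (simp add: slice_N_def)

lemma slice_S_in_sphere: "cmod z < 1 \<Longrightarrow> slice_S z \<in> sphere 0 1"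
  using slice_N_in_sphere[of z] by (simp only: sphere_pair_iff slice_S_swap) (simp add: add.commute)

lemma orbit_meets_slice_N:
  assumes "z \<in> sphere 0 1" "snd z \<noteq> 0" "q > 0"
  obtains w where "cmod w < 1" "orbit p q z = orbit p q (slice_N w)"
proof -
  obtain t where t: "cmod t = 1" "t ^ q * snd z = complex_of_real (cmod (snd z))"
    using rotate_to_positive[OF assms(3,2)] .
  have "(cmod (fst z))\<^sup>2 = 1 - (cmod (snd z))\<^sup>2"
    using assms(1) by (simp only: sphere_pair_iff)
  moreover have n: "cmod (t ^ p * fst z) = cmod (fst z)"
    using t by (simp add: norm_mult norm_power)
  moreover have "(cmod (fst z))\<^sup>2 < 1"
    using calculation(1) assms(2) by simp
  ultimately have "cmod (t ^ p * fst z) < 1" "sqrt (1 - (cmod (t ^ p * fst z))\<^sup>2) = cmod (snd z)"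
    using abs_square_less_1[of "cmod (fst z)"] by auto
  moreover from this have "orbit p q z = orbit p q (slice_N (t ^ p * fst z))"
    unfolding orbit_eq_iff using t by (intro exI[of _ t]) (simp add: slice_N_def)
  ultimately show ?thesis using that by blast
qed

lemma orbit_meets_slice_S:
  assumes "z \<in> sphere 0 1" "fst z \<noteq> 0" "p > 0"
  obtains w where "cmod w < 1" "orbit p q z = orbit p q (slice_S w)"
proof -
  have "prod.swap z \<in> sphere 0 1"
    using assms(1) by (simp only: sphere_pair_iff) (simp add: add.commute)
  then obtain w where "cmod w < 1" "orbit q p (prod.swap z) = orbit q p (slice_N w)"
    using orbit_meets_slice_N[of "prod.swap z" p q] assms by auto
  then show ?thesis
    using that[of w] orbit_swap_eq_iff[of p q "prod.swap z" "slice_N w"] by (simp add: slice_S_swap)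
qed

text \<open>
  The invariants \<open>z\<^sub>0\<^sup>q (cnj z\<^sub>1)\<^sup>p\<close>, \<open>\<bar>z\<^sub>0\<bar>\<close> and \<open>\<bar>z\<^sub>1\<bar>\<close> of the circle action separate the orbits, so they embed the
  spindle continuously and injectively into a Euclidean space.
\<close>

lemma Hausdorff_spindle:
  assumes cop: "coprime p q" and p: "p > 0" and q: "q > 0"
  shows "Hausdorff_space (spindle p q)"
proof -
  define F :: "complex \<times> complex \<Rightarrow> complex \<times> real \<times> real"
    where "F z = (fst z ^ q * cnj (snd z) ^ p, cmod (fst z), cmod (snd z))" for z
  have F_inv: "F w = F z" if "cmod t = 1" "w = (t ^ p * fst z, t ^ q * snd z)" for t z w
  proof -
    have "(t ^ p) ^ q * cnj (t ^ q) ^ p = (t * cnj t) ^ (p * q)"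
      by (simp add: power_mult_distrib power_mult[symmetric] mult.commute)
    also have "\<dots> = 1"
      using that by (simp add: complex_norm_square[symmetric])
    finally show ?thesis
      using that by (simp add: F_def power_mult_distrib norm_mult norm_power mult_ac)
  qed
  have F_inj: "\<exists>t. cmod t = 1 \<and> w = (t ^ p * fst z, t ^ q * snd z)"
    if zw: "z \<in> sphere 0 1" "w \<in> sphere 0 1" and eq: "F z = F w" for z w
  proof -
    have e: "fst z ^ q * cnj (snd z) ^ p = fst w ^ q * cnj (snd w) ^ p"
      "cmod (fst w) = cmod (fst z)" "cmod (snd w) = cmod (snd z)"
      using eq by (auto simp: F_def)
    show ?thesis
    proof (cases "fst z = 0 \<or> snd z = 0")
      case True
      moreover have "\<exists>t. cmod t = 1 \<and> v = t ^ n * u" if "n > 0" "cmod u = cmod v" "u \<noteq> 0" for n u v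
      proof -
        obtain t where t: "v / u = t ^ n"
          using exists_complex_root[of n] \<open>n > 0\<close> by blast
        then have "cmod t ^ n = 1"
          using that by (metis divide_self_if norm_divide norm_eq_zero norm_power)
        then show ?thesis
          using that t by (intro exI[of _ t]) (auto dest: norm_1_if_power_1[rotated] simp: field_simps)
      qed
      moreover have "fst z \<noteq> 0 \<or> snd z \<noteq> 0"
        using zw(1) unfolding sphere_pair_iff by auto
      moreover have "fst z = 0 \<Longrightarrow> fst w = 0" "snd z = 0 \<Longrightarrow> snd w = 0"
        using e by auto
      ultimately show ?thesis
        using p q e(2,3) by (metis mult_zero_right prod.collapse)
    next
      case False
      then have nz: "fst z \<noteq> 0" "snd z \<noteq> 0" "fst w \<noteq> 0" "snd w \<noteq> 0"
        using e by auto
      define a b where "a = fst w / fst z" and "b = snd w / snd z"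
      have ab: "cmod a = 1" "cmod b = 1"
        using nz e by (simp_all add: a_def b_def norm_divide)
      have "a ^ q * cnj b ^ p = 1"
        using nz e(1) by (simp add: a_def b_def power_divide)
      moreover have "b ^ p * cnj b ^ p = 1"
        using ab(2) by (simp add: power_mult_distrib[symmetric] complex_norm_square[symmetric])
      ultimately have "a ^ q = b ^ p"
        by (metis mult_cancel_right mult_zero_right zero_neq_one)
      then obtain t where "cmod t = 1" "t ^ p = a" "t ^ q = b"
        using common_power_root[OF cop p _ ab] by blast
      then show ?thesis
        using nz by (intro exI[of _ t]) (simp add: a_def b_def)
    qed
  qed
  define G where "G x = F (SOME z. z \<in> sphere 0 1 \<and> orbit p q z = x)" for x
  have G: "G (orbit p q z) = F z" if "z \<in> sphere 0 1" for z
  proof -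
    let ?w = "SOME w. w \<in> sphere 0 1 \<and> orbit p q w = orbit p q z"
    have "orbit p q ?w = orbit p q z"
      using someI[of "\<lambda>w. w \<in> sphere 0 1 \<and> orbit p q w = orbit p q z" z] that by blast
    then obtain t where "cmod t = 1" "z = (t ^ p * fst ?w, t ^ q * snd ?w)"
      unfolding orbit_eq_iff[of p q ?w z] by blast
    then have "F z = F ?w" by (rule F_inv)
    then show ?thesis
      unfolding G_def by (rule sym)
  qed
  have "continuous_map (top_of_set (sphere 0 1)) euclidean (G \<circ> orbit p q)"
  proof (rule continuous_map_eq)
    show "continuous_map (top_of_set (sphere 0 1)) euclidean F"
      unfolding continuous_map_iff_continuous F_def by (intro continuous_intros)
  qed (simp add: G)
  then have "continuous_map (spindle p q) euclidean G"
    using continuous_compose_quotient_map[OF quotient_map_orbit] by blast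
  moreover have "inj_on G (topspace (spindle p q))"
    unfolding topspace_spindle
  proof (rule inj_onI, elim imageE, goal_cases)
    case (1 x y z w)
    then have "F z = F w" by (simp only: G)
    with 1 show ?case
      using F_inj[of z w] by (simp only: orbit_eq_iff)
  qed
  ultimately show ?thesis
    by (rule Hausdorff_space_injective_preimage[OF Hausdorff_space_euclidean])
qed

lemma connected_spindle: "connected_space (spindle p q)"
proof -
  have "connected (sphere (0 :: complex \<times> complex) 1)"
    by (rule connected_sphere) simp
  then have "connected_space (top_of_set (sphere (0 :: complex \<times> complex) 1))"
    by (simp add: connected_space_subtopology)
  then show ?thesis
    using connected_space_quotient_map_image[OF quotient_map_orbit] by blast
qed

lemma continuous_map_slice_N:
  "continuous_map (top_of_set (ball 0 1)) (spindle p q) (\<lambda>z. orbit p q (slice_N z))"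
proof -
  have "continuous_map (top_of_set (ball 0 1)) (top_of_set (sphere 0 1)) slice_N"
    using slice_N_in_sphere unfolding continuous_map_in_subtopology continuous_map_iff_continuous
    by (auto simp: slice_N_def[abs_def] intro!: continuous_intros)
  from continuous_map_compose[OF this quotient_imp_continuous_map[OF quotient_map_orbit]]
  show ?thesis by (simp add: o_def)
qed

lemma continuous_map_slice_S:
  "continuous_map (top_of_set (ball 0 1)) (spindle p q) (\<lambda>z. orbit p q (slice_S z))"
proof -
  have "continuous_map (top_of_set (ball 0 1)) (top_of_set (sphere 0 1)) slice_S"
    using slice_S_in_sphere unfolding continuous_map_in_subtopology continuous_map_iff_continuous
    by (auto simp: slice_S_def[abs_def] intro!: continuous_intros)
  from continuous_map_compose[OF this quotient_imp_continuous_map[OF quotient_map_orbit]]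
  show ?thesis by (simp add: o_def)
qed

section \<open>Cone charts and the maximal atlas\<close>

lemma smooth_on_has_derivative:
  assumes "smooth_on S f" "x \<in> S"
  shows "(f has_derivative frechet_derivative f (at x)) (at x)"
proof -
  have "Ck_on (Suc 0) S f"
    using assms(1) unfolding smooth_on_def by blast
  then show ?thesis
    using assms(2) by (simp add: frechet_derivative_works)
qed

lemma smooth_on_continuous:
  assumes "smooth_on S f"
  shows "continuous_on S f"
proof -
  have "Ck_on 0 S f"
    using assms(1) unfolding smooth_on_def by blast
  then show ?thesis by simp
qed

text \<open>
  The two charts of the atlas with the order of the cone point at their centre and their area density.
  Both satisfy the same few facts, so that arguments about lifts need not distinguish them.
\<close>

definition cone_charts :: "nat \<Rightarrow> nat \<Rightarrow> ((complex \<times> complex) set orb_chart \<times> nat \<times> (complex \<Rightarrow> real)) set" where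
  "cone_charts p q = {(chart_N p q, q, area_density p q), (chart_S p q, p, area_density q p)}"

locale spindle_weights =
  fixes p q :: nat
  assumes p2: "p \<ge> 2" and q2: "q \<ge> 2" and cop: "coprime p q"
begin

abbreviation "X \<equiv> spindle p q"
abbreviation "charts \<equiv> maximal_atlas X (spindle_atlas p q)"
abbreviation "proj_N \<equiv> cmap (chart_N p q)"
abbreviation "proj_S \<equiv> cmap (chart_S p q)"
abbreviation "pole_N \<equiv> proj_N 0"
abbreviation "pole_S \<equiv> proj_S 0"

lemma proj_N_def: "proj_N z = orbit p q (slice_N z)"
  by (simp add: chart_N_def)

lemma proj_S_def: "proj_S z = orbit p q (slice_S z)"
  by (simp add: chart_S_def)

lemma p0: "p > 0" and q0: "q > 0"
  using p2 q2 by auto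

lemma cone_order: "(b, m, \<rho>) \<in> cone_charts p q \<Longrightarrow> m \<ge> 2"
  using p2 q2 by (auto simp: cone_charts_def)

lemma cone_atlas: "(b, m, \<rho>) \<in> cone_charts p q \<Longrightarrow> b \<in> spindle_atlas p q"
  by (auto simp: cone_charts_def spindle_atlas_def)

lemma cone_dom: "(b, m, \<rho>) \<in> cone_charts p q \<Longrightarrow> cdom b = ball 0 1"
  by (auto simp: cone_charts_def chart_N_def chart_S_def)

lemma cone_density_pos: "(b, m, \<rho>) \<in> cone_charts p q \<Longrightarrow> z \<in> ball 0 1 \<Longrightarrow> \<rho> z > 0"
  using area_density_pos[of z p q] area_density_pos[of z q p] p0 q0 by (auto simp: cone_charts_def)

lemma cone_continuous:
  "(b, m, \<rho>) \<in> cone_charts p q \<Longrightarrow> continuous_map (top_of_set (ball 0 1)) X (cmap b)"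
  using continuous_map_slice_N[of p q] continuous_map_slice_S[of p q]
  by (auto simp: cone_charts_def chart_N_def chart_S_def)

lemma cone_eq_iff:
  assumes "(b, m, \<rho>) \<in> cone_charts p q" "z \<in> ball 0 1" "w \<in> ball 0 1"
  shows "cmap b z = cmap b w \<longleftrightarrow> (\<exists>\<zeta>. \<zeta> ^ m = 1 \<and> w = \<zeta> * z)"
proof -
  have "orbit p q (slice_N z) = orbit p q (slice_N w) \<longleftrightarrow> (\<exists>\<zeta>. \<zeta> ^ q = 1 \<and> w = \<zeta> * z)"
    using orbit_slice_N_eq_iff[OF cop p0 q0, of z w] assms by simp
  moreover have "orbit p q (slice_S z) = orbit p q (slice_S w) \<longleftrightarrow> (\<exists>\<zeta>. \<zeta> ^ p = 1 \<and> w = \<zeta> * z)"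
    using orbit_slice_N_eq_iff[of q p z w] assms cop p0 q0
    by (simp add: slice_S_swap orbit_swap_eq_iff coprime_commute)
  ultimately show ?thesis
    using assms(1) by (auto simp: cone_charts_def chart_N_def chart_S_def)
qed

lemma cone_cover:
  assumes "x \<in> topspace X"
  obtains b m \<rho> z where "(b, m, \<rho>) \<in> cone_charts p q" "z \<in> ball 0 1" "cmap b z = x"
proof -
  obtain y where y: "y \<in> sphere 0 1" "x = orbit p q y"
    using assms by (auto simp: topspace_spindle)
  then have "fst y \<noteq> 0 \<or> snd y \<noteq> 0"
    unfolding sphere_pair_iff by auto
  then have "(\<exists>z\<in>ball 0 1. proj_N z = x) \<or> (\<exists>z\<in>ball 0 1. proj_S z = x)"
    using orbit_meets_slice_N[OF y(1) _ q0, of p] orbit_meets_slice_S[OF y(1) _ p0, of q] y(2)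
    unfolding proj_N_def proj_S_def by (metis mem_ball_0)
  then show ?thesis
    using that unfolding cone_charts_def by blast
qed

lemma topspace_eq: "topspace X = insert pole_S (proj_N ` ball 0 1)"
proof
  have "x = pole_S \<or> x \<in> proj_N ` ball 0 1" if x: "x \<in> topspace X" for x
  proof -
    obtain y where y: "y \<in> sphere 0 1" "x = orbit p q y"
      using x by (auto simp: topspace_spindle)
    show ?thesis
    proof (cases "snd y = 0")
      case True
      then have "cmod (fst y) = 1"
        using y(1) by (simp only: sphere_pair_iff) (simp add: power2_eq_1_iff, smt norm_ge_zero)
      then obtain t where "cmod t = 1" "t ^ p * fst y = 1"
        using rotate_to_positive[OF p0, of "fst y"] by force
      then have "orbit p q y = pole_S"
        unfolding proj_S_def orbit_eq_iff using True by (auto simp: slice_S_def)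
      with y show ?thesis by simp
    next
      case False
      then show ?thesis
        using orbit_meets_slice_N[OF y(1) _ q0, of p] y(2) unfolding proj_N_def
        by (metis image_eqI mem_ball_0)
    qed
  qed
  then show "topspace X \<subseteq> insert pole_S (proj_N ` ball 0 1)" by blast
  show "insert pole_S (proj_N ` ball 0 1) \<subseteq> topspace X"
    using slice_N_in_sphere slice_S_in_sphere[of 0]
    by (auto simp: topspace_spindle proj_N_def proj_S_def simp del: mem_sphere_0)
qed

lemma cone_eq_pole_iff:
  assumes "(b, m, \<rho>) \<in> cone_charts p q" "z \<in> ball 0 1"
  shows "cmap b z \<in> {pole_N, pole_S} \<longleftrightarrow> z = 0"
proof -
  have NS: "proj_N w \<noteq> pole_S" if "cmod w < 1" for w
    unfolding proj_N_def proj_S_def orbit_eq_iff using that p0 q0 abs_square_less_1[of "cmod w"]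
    by (auto simp: slice_N_def slice_S_def)
  have SN: "proj_S w \<noteq> pole_N" if "cmod w < 1" for w
    unfolding proj_N_def proj_S_def orbit_eq_iff using that p0 q0 abs_square_less_1[of "cmod w"]
    by (auto simp: slice_N_def slice_S_def)
  have "cmap b z = cmap b 0 \<longleftrightarrow> z = 0"
    using cone_eq_iff[OF assms(1) _ assms(2), of 0] by (auto intro: exI[of _ 1])
  then show ?thesis
    using assms NS[of z] SN[of z] by (auto simp: cone_charts_def)
qed

lemma poles_distinct: "pole_N \<noteq> pole_S"
  unfolding proj_N_def proj_S_def orbit_eq_iff using p0 q0
  by (auto simp: slice_N_def slice_S_def)

lemma poles_in_topspace: "pole_N \<in> topspace X" "pole_S \<in> topspace X"
  unfolding topspace_eq by auto

lemma cone_area_form: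
  assumes b: "(b, m, \<rho>) \<in> cone_charts p q" and W: "y \<in> W" "chart_change c b W h"
  shows "area_form_at p q c y (\<lambda>v w. \<rho> (h y) *
    signed_area (frechet_derivative h (at y) v) (frechet_derivative h (at y) w))"
proof -
  have "cmod (h y) < 1"
    using W cone_dom[OF b] by (auto simp: chart_change_def)
  then have form: "metric_area_form (submersion_metric p q slice_N) (h y) v w = area_density p q (h y) * signed_area v w"
    "metric_area_form (submersion_metric p q slice_S) (h y) v w = area_density q p (h y) * signed_area v w" for v w
    by (simp_all add: submersion_area_slice_N submersion_area_slice_S p0 q0)
  consider "b = chart_N p q" "\<rho> = area_density p q" | "b = chart_S p q" "\<rho> = area_density q p"
    using b by (auto simp: cone_charts_def)
  then show ?thesis
  proof cases
    case 1
    show ?thesis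
      unfolding area_form_at_def
    proof (rule bexI[of _ "(chart_N p q, slice_N)"], unfold prod.case, intro exI conjI)
      show "y \<in> W" "chart_change c (chart_N p q) W h" using W 1 by simp_all
    qed (simp_all add: fun_eq_iff pullback_form_def form 1)
  next
    case 2
    show ?thesis
      unfolding area_form_at_def
    proof (rule bexI[of _ "(chart_S p q, slice_S)"], unfold prod.case, intro exI conjI)
      show "y \<in> W" "chart_change c (chart_S p q) W h" using W 2 by simp_all
    qed (simp_all add: fun_eq_iff pullback_form_def form 2)
  qed
qed

text \<open>
  What compatibility with the atlas provides: a point of an arbitrary chart over a point of a cone chart
  has a neighbourhood identified by \<open>h\<close>, with inverse \<open>k\<close>, with an open set of the disc, and this
  identification computes the area form of the chart at that point.
\<close>

lemma chart_comparison:
  assumes c: "c \<in> charts" and b: "(b, m, \<rho>) \<in> cone_charts p q"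
    and y: "y \<in> cdom c" and x: "x \<in> ball 0 1" and eq: "cmap c y = cmap b x"
  obtains W h k where "open W" "y \<in> W" "W \<subseteq> cdom c" "h y = x" "open (h ` W)" "h ` W \<subseteq> ball 0 1"
    "\<And>z. z \<in> W \<Longrightarrow> k (h z) = z" "continuous_on W h" "continuous_on (h ` W) k"
    "\<And>z. z \<in> W \<Longrightarrow> cmap b (h z) = cmap c z"
    "(h has_derivative frechet_derivative h (at y)) (at y)"
    "(k has_derivative frechet_derivative k (at x)) (at x)"
    "\<And>v. frechet_derivative h (at y) (frechet_derivative k (at x) v) = v"
    "area_form_at p q c y (\<lambda>v w. \<rho> x *
       signed_area (frechet_derivative h (at y) v) (frechet_derivative h (at y) w))"
proof -
  have "charts_compatible c b"
    using c cone_atlas[OF b] by (auto simp: maximal_atlas_def)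
  then obtain W h where W: "y \<in> W" "chart_change c b W h" "h y = x"
    unfolding charts_compatible_def using y x cone_dom[OF b] eq by metis
  then have diffeo: "open W" "open (h ` W)" "smooth_on W h"
    and incl: "W \<subseteq> cdom c" "h ` W \<subseteq> ball 0 1" "\<And>z. z \<in> W \<Longrightarrow> cmap b (h z) = cmap c z"
    unfolding chart_change_def diffeomorphism_on_def cone_dom[OF b] by auto
  obtain k where k: "smooth_on (h ` W) k" "homeomorphism W (h ` W) h k"
    using W(2) unfolding chart_change_def diffeomorphism_on_def by blast
  have kh: "k (h z) = z" if "z \<in> W" for z
    using k(2) that by (simp add: homeomorphism_apply1)
  have xW: "x \<in> h ` W" and kx: "k x = y"
    using W kh by auto
  have Dh: "(h has_derivative frechet_derivative h (at y)) (at y)"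
    using smooth_on_has_derivative[OF diffeo(3) W(1)] .
  have Dk: "(k has_derivative frechet_derivative k (at x)) (at x)"
    using smooth_on_has_derivative[OF k(1) xW] .
  have "((\<lambda>u. h (k u)) has_derivative (\<lambda>v. frechet_derivative h (at y) (frechet_derivative k (at x) v))) (at x)"
    using has_derivative_compose[OF Dk, of h] Dh by (simp add: kx)
  moreover have "((\<lambda>u. h (k u)) has_derivative (\<lambda>v. v)) (at x)"
  proof (rule has_derivative_transform_within_open)
    show "((\<lambda>u. u) has_derivative (\<lambda>v. v)) (at x)" by (rule has_derivative_ident)
    show "u = h (k u)" if "u \<in> h ` W" for u
      using k(2) that by (simp add: homeomorphism_apply2)
  qed (use diffeo xW in auto)
  ultimately have "frechet_derivative h (at y) (frechet_derivative k (at x) v) = v" for v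
    by (rule fun_cong[OF has_derivative_unique])
  moreover have "area_form_at p q c y (\<lambda>v w. \<rho> x *
       signed_area (frechet_derivative h (at y) v) (frechet_derivative h (at y) w))"
    using cone_area_form[OF b W(1,2)] W(3) by simp
  ultimately show ?thesis
    by (intro that[of W h k] W diffeo incl kh Dh Dk smooth_on_continuous[OF k(1)] smooth_on_continuous[OF diffeo(3)])
qed

end

section \<open>Isotropy at regular points and local lifts\<close>

context spindle_weights
begin

lemma cone_inj_near:
  assumes b: "(b, m, \<rho>) \<in> cone_charts p q" and x: "x \<in> ball 0 1" "x \<noteq> 0"
  obtains r where "r > 0" "ball x r \<subseteq> ball 0 1" "inj_on (cmap b) (ball x r)"
proof -
  have "finite {\<zeta> :: complex. \<zeta> ^ m = 1}"
    using cone_order[OF b] by (intro finite_roots_unity) auto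
  from finite_set_avoid[OF this, of 1]
  obtain \<delta> where \<delta>: "\<delta> > 0" "\<And>\<zeta>. \<zeta> ^ m = 1 \<Longrightarrow> \<zeta> \<noteq> 1 \<Longrightarrow> \<delta> \<le> cmod (\<zeta> - 1)"
    by (auto simp: dist_norm norm_minus_commute)
  \<comment> \<open>Points of the ball are longer than \<open>\<bar>x\<bar> / 2\<close>, so a nontrivial rotation moves them by more than \<open>\<delta> \<bar>x\<bar> / 2\<close>.\<close>
  define r where "r = min (1 - cmod x) (min (cmod x / 2) (\<delta> * cmod x / 4))"
  have r: "r \<le> 1 - cmod x" "r \<le> cmod x / 2" "r \<le> \<delta> * cmod x / 4"
    unfolding r_def by linarith+
  have r0: "r > 0"
    using x \<delta>(1) by (simp add: r_def)
  have sub: "ball x r \<subseteq> ball 0 1"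
  proof
    fix w assume "w \<in> ball x r"
    then show "w \<in> ball 0 1"
      using r norm_triangle_ineq2[of w x] by (simp add: dist_norm norm_minus_commute)
  qed
  moreover have "inj_on (cmap b) (ball x r)"
  proof (rule inj_onI, rule ccontr)
    fix w w' assume w: "w \<in> ball x r" "w' \<in> ball x r" "cmap b w = cmap b w'" "w \<noteq> w'"
    then obtain \<zeta> where \<zeta>: "\<zeta> ^ m = 1" "w' = \<zeta> * w"
      using cone_eq_iff[OF b, of w w'] sub by blast
    then have "\<delta> \<le> cmod (\<zeta> - 1)"
      using \<delta>(2) w(4) by auto
    moreover have "cmod x / 2 < cmod w"
      using w(1) r norm_triangle_ineq2[of x w] by (simp add: dist_norm)
    ultimately have "\<delta> * (cmod x / 2) < cmod (\<zeta> - 1) * cmod w"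
      using \<delta>(1) x(2) by (intro mult_le_less_imp_less) auto
    also have "\<dots> = dist w' w"
      by (simp add: \<zeta>(2) dist_norm norm_mult[symmetric] algebra_simps)
    also have "\<dots> < 2 * r"
      using w(1,2) dist_triangle2[of w' w x] by (simp add: dist_commute)
    finally show False using r by simp
  qed
  ultimately show ?thesis using that r0 by blast
qed

lemma charts_orbifold_chart: "c \<in> charts \<Longrightarrow> orbifold_chart X c"
  by (simp add: maximal_atlas_def)

lemma charts_image_in_topspace: "c \<in> charts \<Longrightarrow> y \<in> cdom c \<Longrightarrow> cmap c y \<in> topspace X"
  using charts_orbifold_chart[of c] openin_subset[of X "cimage c"] by (auto simp: orbifold_chart_def)

lemma chart_inj_near:
  assumes c: "c \<in> charts" and y: "y \<in> cdom c" and reg: "cmap c y \<notin> {pole_N, pole_S}"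
  obtains U where "open U" "y \<in> U" "U \<subseteq> cdom c" "inj_on (cmap c) U"
proof -
  obtain b m \<rho> x where b: "(b, m, \<rho>) \<in> cone_charts p q" and x: "x \<in> ball 0 1" "cmap b x = cmap c y"
    using cone_cover[OF charts_image_in_topspace[OF c y]] .
  have "x \<noteq> 0"
    using cone_eq_pole_iff[OF b x(1)] x(2) reg by simp
  then obtain r where r: "r > 0" "ball x r \<subseteq> ball 0 1" "inj_on (cmap b) (ball x r)"
    using cone_inj_near[OF b x(1)] by blast
  obtain W h k where W: "open W" "y \<in> W" "W \<subseteq> cdom c" "h y = x" "\<And>z. z \<in> W \<Longrightarrow> k (h z) = z"
      "continuous_on W h" "\<And>z. z \<in> W \<Longrightarrow> cmap b (h z) = cmap c z"
    by (rule chart_comparison[OF c b y x(1) x(2)[symmetric]]) (rule that; assumption)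
  have "open (W \<inter> h -` ball x r)"
    using W by (intro continuous_open_preimage) auto
  moreover have "inj_on (cmap c) (W \<inter> h -` ball x r)"
  proof (rule inj_onI)
    fix u v assume uv: "u \<in> W \<inter> h -` ball x r" "v \<in> W \<inter> h -` ball x r" "cmap c u = cmap c v"
    then have "cmap b (h u) = cmap b (h v)"
      using W(7)[of u] W(7)[of v] by simp
    moreover have "h u \<in> ball x r" "h v \<in> ball x r"
      using uv(1,2) by simp_all
    ultimately have "h u = h v"
      by (rule inj_onD[OF r(3)])
    then have "k (h u) = k (h v)" by simp
    then show "u = v"
      using W(5) uv(1,2) by (simp only: Int_iff)
  qed
  moreover have "y \<in> W \<inter> h -` ball x r" "W \<inter> h -` ball x r \<subseteq> cdom c"
    using W(2-4) r(1) by auto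
  ultimately show ?thesis
    by (intro that)
qed

lemma chart_fibre_finite:
  assumes c: "c \<in> charts"
  shows "finite {w \<in> cdom c. cmap c w = x}"
proof (cases "\<exists>w\<in>cdom c. cmap c w = x")
  case True
  then obtain w where w: "w \<in> cdom c" "cmap c w = x" by blast
  have "{v \<in> cdom c. cmap c v = x} \<subseteq> (\<lambda>g. g w) ` cgrp c"
    using charts_orbifold_chart[OF c] w unfolding orbifold_chart_def by blast
  moreover have "finite (cgrp c)"
    using charts_orbifold_chart[OF c] by (simp add: orbifold_chart_def)
  ultimately show ?thesis
    using finite_surj by blast
next
  case False
  then have "{w \<in> cdom c. cmap c w = x} = {}" by blast
  then show ?thesis by (simp only: finite.emptyI)
qed

text \<open>
  The chart map is injective near a point over a regular point, and a group element commutes with the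
  chart map, so a group element fixing such a point is the identity near it. The points over
  the cone points form a finite set, whose complement stays connected; there the fixed points form an
  open and closed set, and being fixed passes to the finite remainder by continuity.
\<close>

lemma regular_isotropy_trivial:
  assumes c: "c \<in> charts" and z: "z \<in> cdom c" "cmap c z \<notin> {pole_N, pole_S}"
    and g: "g \<in> cgrp c" "g z = z" and w: "w \<in> cdom c"
  shows "g w = w"
proof (rule ccontr)
  assume gw: "g w \<noteq> w"
  have op: "open (cdom c)" and co: "connected (cdom c)"
    and smooth: "smooth_on (cdom c) g"
    and fib: "\<And>v. v \<in> cdom c \<Longrightarrow> g v \<in> cdom c \<Longrightarrow> cmap c (g v) = cmap c v"
    and grp: "cgrp c \<subseteq> Bij (cdom c)"
    using charts_orbifold_chart[OF c] g subgroup.subset[of "cgrp c" "BijGroup (cdom c)"]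
    unfolding orbifold_chart_def by (auto simp: BijGroup_def) metis
  have gdom: "g v \<in> cdom c" if "v \<in> cdom c" for v
    using grp g(1) that by (auto simp: Bij_def bij_betw_def)
  have cont: "continuous_on (cdom c) g"
    using smooth_on_continuous[OF smooth] .
  define P where "P = {v \<in> cdom c. cmap c v \<in> {pole_N, pole_S}}"
  have "P = {v \<in> cdom c. cmap c v = pole_N} \<union> {v \<in> cdom c. cmap c v = pole_S}"
    by (auto simp: P_def)
  then have finP: "finite P"
    using chart_fibre_finite[OF c] by simp
  have conn: "connected (cdom c - P)"
    by (rule connected_open_delete_finite[OF op co _ finP]) simp
  have opP: "open (cdom c - P)"
    using op finP by (simp add: finite_imp_closed open_Diff)
  have "openin (top_of_set (cdom c - P)) {v \<in> cdom c - P. g v - v = 0}"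
  proof -
    have "\<exists>T. open T \<and> v \<in> T \<and> T \<subseteq> {v \<in> cdom c - P. g v - v = 0}"
      if v: "v \<in> cdom c - P" "g v = v" for v
    proof -
      obtain U where U: "open U" "v \<in> U" "U \<subseteq> cdom c" "inj_on (cmap c) U"
        using chart_inj_near[OF c, of v] v by (auto simp: P_def)
      let ?T = "((cdom c \<inter> g -` U) \<inter> U) \<inter> (cdom c - P)"
      have "open ?T"
        using cont op U(1) opP by (intro open_Int continuous_open_preimage)
      moreover have "g u = u" if "u \<in> ?T" for u
        using U(4) fib[of u] gdom[of u] that by (auto simp: inj_on_def)
      ultimately show ?thesis
        using v U(2) by (intro exI[of _ ?T]) auto
    qed
    then have "open {v \<in> cdom c - P. g v - v = 0}"
      by (subst open_subopen) auto
    then show ?thesis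
      by (simp only: openin_open_eq[OF opP]) auto
  qed
  moreover have "continuous_on (cdom c - P) (\<lambda>v. g v - v)"
    using cont by (intro continuous_intros) (auto intro: continuous_on_subset)
  ultimately have "(\<forall>v\<in>cdom c - P. g v - v \<noteq> 0) \<or> (\<forall>v\<in>cdom c - P. g v - v = 0)"
    using continuous_levelset_openin_cases[OF conn] by blast
  moreover have "z \<in> cdom c - P"
    using z by (simp add: P_def)
  ultimately have id: "\<forall>v\<in>cdom c - P. g v - v = 0"
    using g(2) by auto
  \<comment> \<open>The points moved by \<open>g\<close> form an open set inside the finite set \<open>P\<close>.\<close>
  have "open (cdom c \<inter> (\<lambda>v. g v - v) -` (- {0}))"
    using cont op by (intro continuous_open_preimage continuous_intros) auto
  from interior_open[OF this] have "w \<in> interior (cdom c \<inter> (\<lambda>v. g v - v) -` (- {0}))"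
    using w gw by (simp only:) simp
  then have "w islimpt cdom c \<inter> (\<lambda>v. g v - v) -` (- {0})"
    by (rule interior_limit_point)
  moreover have "finite (cdom c \<inter> (\<lambda>v. g v - v) -` (- {0}))"
    using id by (intro finite_subset[OF _ finP]) auto
  ultimately show False
    using islimpt_finite by blast
qed

lemma singular_points_subset: "singular_points X (spindle_atlas p q) \<subseteq> {pole_N, pole_S}"
proof (rule subsetI, rule ccontr)
  fix x assume "x \<in> singular_points X (spindle_atlas p q)" and x: "x \<notin> {pole_N, pole_S}"
  then obtain c z where c: "c \<in> charts" and z: "z \<in> cdom c" "cmap c z = x"
    and ne: "{g \<in> cgrp c. g z = z} \<noteq> {\<one>\<^bsub>BijGroup (cdom c)\<^esub>}"
    by (auto simp: singular_points_def)
  have sub: "subgroup (cgrp c) (BijGroup (cdom c))"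
    using charts_orbifold_chart[OF c] by (simp add: orbifold_chart_def)
  have "g = \<one>\<^bsub>BijGroup (cdom c)\<^esub>" if g: "g \<in> cgrp c" "g z = z" for g
  proof -
    have "g \<in> extensional (cdom c)"
      using subgroup.subset[OF sub] g(1) by (auto simp: BijGroup_def Bij_def)
    then show ?thesis
      using regular_isotropy_trivial[OF c z(1) _ g] z(2) x
      by (auto simp: BijGroup_def extensional_def restrict_def fun_eq_iff)
  qed
  moreover have "\<one>\<^bsub>BijGroup (cdom c)\<^esub> \<in> {g \<in> cgrp c. g z = z}"
    using subgroup.one_closed[OF sub] z(1) by (simp add: BijGroup_def)
  ultimately show False using ne by blast
qed

text \<open>
  Every value of \<open>f\<close> is computed in charts of the maximal atlas; composing the local lift with the
  comparisons to two cone charts gives a lift between discs, defined near the chosen point. The identity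
  between the area forms, evaluated on the images of \<open>1\<close> and \<open>\<i>\<close>, becomes one about the Jacobian.
\<close>

lemma area_preserving_lift:
  assumes f: "smooth_orbifold_map X (spindle_atlas p q) X (spindle_atlas p q) f"
    and area: "area_preserving p q f"
    and b: "(b, m, \<rho>) \<in> cone_charts p q" and b': "(b', m', \<rho>') \<in> cone_charts p q"
    and x: "x \<in> ball 0 1" and x': "x' \<in> ball 0 1" and fx: "f (cmap b x) = cmap b' x'"
  obtains H L where "H x = x'" "(H has_derivative L) (at x)" "\<rho>' x' * jacobian L = \<rho> x"
    "\<forall>\<^sub>F w in nhds x. w \<in> ball 0 1 \<and> H w \<in> ball 0 1 \<and> cmap b' (H w) = f (cmap b w)"
proof -
  have "cmap b x \<in> topspace X"
    using cone_continuous[OF b] x by (auto simp: continuous_map_def)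
  moreover have "\<forall>x\<in>topspace X. \<exists>c\<in>charts. \<exists>d\<in>charts.
      x \<in> cimage c \<and> f x \<in> cimage d \<and> (\<exists>g. local_lift f c d g)"
    using f unfolding smooth_orbifold_map_def by (rule conjunct2)
  ultimately have "\<exists>c\<in>charts. \<exists>d\<in>charts.
      cmap b x \<in> cimage c \<and> f (cmap b x) \<in> cimage d \<and> (\<exists>g. local_lift f c d g)"
    by (rule bspec[rotated])
  then obtain c d g where c: "c \<in> charts" and d: "d \<in> charts" and xc: "cmap b x \<in> cimage c"
    and lift: "local_lift f c d g"
    by (elim bexE conjE exE) (rule that)
  from xc obtain y where y: "y \<in> cdom c" "cmap c y = cmap b x"
    by (elim imageE) (rule that, simp_all)
  have g: "smooth_on (cdom c) g" "g ` cdom c \<subseteq> cdom d" "\<And>z. z \<in> cdom c \<Longrightarrow> cmap d (g z) = f (cmap c z)"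
    using lift by (auto simp: local_lift_def)
  have gy: "g y \<in> cdom d" "cmap d (g y) = cmap b' x'"
    using g y fx by auto
  obtain W h k where W: "open W" "y \<in> W" "W \<subseteq> cdom c" "h y = x" "open (h ` W)" "h ` W \<subseteq> ball 0 1"
    "\<And>z. z \<in> W \<Longrightarrow> k (h z) = z" "continuous_on (h ` W) k"
    "\<And>z. z \<in> W \<Longrightarrow> cmap b (h z) = cmap c z"
    "(h has_derivative frechet_derivative h (at y)) (at y)"
    and Dk: "(k has_derivative frechet_derivative k (at x)) (at x)"
    and hk: "\<And>v. frechet_derivative h (at y) (frechet_derivative k (at x) v) = v"
    and area_c: "area_form_at p q c y (\<lambda>v w. \<rho> x *
       signed_area (frechet_derivative h (at y) v) (frechet_derivative h (at y) w))"
    by (rule chart_comparison[OF c b y(1) x y(2)]) (rule that; assumption)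
  obtain W' h' where W': "open W'" "g y \<in> W'" "W' \<subseteq> cdom d" "h' (g y) = x'" "h' ` W' \<subseteq> ball 0 1"
    "\<And>z. z \<in> W' \<Longrightarrow> cmap b' (h' z) = cmap d z"
    and Dh': "(h' has_derivative frechet_derivative h' (at (g y))) (at (g y))"
    and area_d: "area_form_at p q d (g y) (\<lambda>v w. \<rho>' x' *
       signed_area (frechet_derivative h' (at (g y)) v) (frechet_derivative h' (at (g y)) w))"
    by (rule chart_comparison[OF d b' gy(1) x' gy(2)]) (rule that; assumption)
  have kx: "k x = y" and xW: "x \<in> h ` W" using W(2,4,7) by auto
  define H where "H = (\<lambda>w. h' (g (k w)))"
  define Dk where "Dk = frechet_derivative k (at x)"
  define Dg where "Dg = frechet_derivative g (at y)"
  define Dh where "Dh = frechet_derivative h (at y)"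
  define Dh' where "Dh' = frechet_derivative h' (at (g y))"
  define L where "L = (\<lambda>v. Dh' (Dg (Dk v)))"
  have "((\<lambda>w. g (k w)) has_derivative (\<lambda>v. Dg (Dk v))) (at x)"
    using has_derivative_compose[OF \<open>(k has_derivative _) _\<close>, of g Dg]
      smooth_on_has_derivative[OF g(1) y(1)] by (simp add: kx Dg_def Dk_def)
  from has_derivative_compose[OF this, of h' Dh']
  have DH: "(H has_derivative L) (at x)"
    using \<open>(h' has_derivative _) _\<close> by (simp add: kx Dh'_def L_def H_def)
  have "pullback_form g (\<lambda>_ v w. \<rho>' x' * signed_area (Dh' v) (Dh' w)) y
      = (\<lambda>v w. \<rho> x * signed_area (Dh v) (Dh w))"
    using area[unfolded area_preserving_def, rule_format, OF c d lift y(1) area_c area_d]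
    by (simp add: Dh_def Dh'_def)
  then have "\<rho>' x' * signed_area (Dh' (Dg v)) (Dh' (Dg w)) = \<rho> x * signed_area (Dh v) (Dh w)" for v w
    unfolding pullback_form_def Dg_def by meson
  from this[of "Dk 1" "Dk \<i>"] have "\<rho>' x' * jacobian L = \<rho> x"
    using hk by (simp add: jacobian_def L_def Dh_def Dk_def) (simp add: signed_area_def)
  moreover have "\<forall>\<^sub>F w in nhds x. w \<in> ball 0 1 \<and> H w \<in> ball 0 1 \<and> cmap b' (H w) = f (cmap b w)"
    unfolding eventually_nhds
  proof (intro exI conjI ballI)
    let ?O = "h ` W \<inter> (\<lambda>w. g (k w)) -` W'"
    have kW: "k ` h ` W \<subseteq> cdom c" using W(3,7) by auto
    have "continuous_on (h ` W) (\<lambda>w. g (k w))"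
      by (rule continuous_on_compose2[OF smooth_on_continuous[OF g(1)] W(8) kW])
    then show "open ?O"
      using W(5) W'(1) by (intro continuous_open_preimage)
    show "x \<in> ?O" using xW W'(2) by (simp add: kx)
    fix w assume w: "w \<in> ?O"
    then obtain z where z: "z \<in> W" "w = h z" by blast
    then have kw: "k w = z" "z \<in> cdom c" using W(3,7) by auto
    show "w \<in> ball 0 1" using w W(6) by blast
    show "H w \<in> ball 0 1" using w W'(5) by (auto simp: H_def)
    have "cmap b' (H w) = cmap d (g z)"
      using W'(6) w by (simp add: H_def kw)
    also have "\<dots> = f (cmap b w)"
      using g(3) kw W(9)[OF z(1)] z(2) by simp
    finally show "cmap b' (H w) = f (cmap b w)" .
  qed
  ultimately show ?thesis
    using that[of H L] DH W'(4) by (simp add: H_def kx)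
qed

end

section \<open>The cone points are fixed\<close>

lemma limit_frequently_const:
  fixes f :: "'a \<Rightarrow> 'b::t1_space"
  assumes "(f \<longlongrightarrow> l) F" "\<exists>\<^sub>F x in F. f x = c"
  shows "l = c"
proof (rule ccontr)
  assume "l \<noteq> c"
  then have "\<forall>\<^sub>F x in F. f x \<noteq> c"
    using tendsto_imp_eventually_ne[OF assms(1)] by blast
  then show False
    using assms(2) by (simp add: frequently_def)
qed

context spindle_weights
begin

text \<open>
  The values of the lift \<open>H\<close> at \<open>t \<zeta> v\<close> and \<open>t v\<close> lie over the same point, hence differ by a root of unity
  depending on \<open>t\<close>. As there are finitely many of them, one occurs for arbitrarily small \<open>t\<close>, and
  comparing values and derivatives along these \<open>t\<close> gives the claim.
\<close>

lemma lift_derivative_intertwines: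
  assumes b: "(b, m, \<rho>) \<in> cone_charts p q" and b': "(b', m', \<rho>') \<in> cone_charts p q"
    and H: "(H has_derivative L) (at 0)"
    and lift: "\<forall>\<^sub>F w in nhds 0. w \<in> ball 0 1 \<and> H w \<in> ball 0 1 \<and> cmap b' (H w) = f (cmap b w)"
    and \<zeta>: "\<zeta> ^ m = 1"
  obtains \<zeta>' where "\<zeta>' ^ m' = 1" "\<zeta>' * H 0 = H 0" "L (\<zeta> * v) = \<zeta>' * L v"
proof -
  let ?R = "{\<zeta>' :: complex. \<zeta>' ^ m' = 1}"
  have near: "\<forall>\<^sub>F t::real in at 0. t *\<^sub>R u \<in> ball 0 1 \<and> H (t *\<^sub>R u) \<in> ball 0 1 \<and>
      cmap b' (H (t *\<^sub>R u)) = f (cmap b (t *\<^sub>R u))" for u :: complex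
  proof -
    have "((\<lambda>t::real. t *\<^sub>R u) \<longlongrightarrow> 0 *\<^sub>R u) (at 0)"
      by (intro tendsto_intros)
    then have "filterlim (\<lambda>t::real. t *\<^sub>R u) (nhds 0) (at 0)"
      by simp
    from eventually_compose_filterlim[OF lift this] show ?thesis .
  qed
  have "\<forall>\<^sub>F t::real in at 0. \<exists>\<zeta>'\<in>?R. H (t *\<^sub>R (\<zeta> * v)) = \<zeta>' * H (t *\<^sub>R v)"
    using near[of v] near[of "\<zeta> * v"]
  proof eventually_elim
    case (elim t)
    have "cmap b (t *\<^sub>R v) = cmap b (t *\<^sub>R (\<zeta> * v))"
      using elim cone_eq_iff[OF b, of "t *\<^sub>R v" "t *\<^sub>R (\<zeta> * v)"] \<zeta> by auto
    then have "cmap b' (H (t *\<^sub>R v)) = cmap b' (H (t *\<^sub>R (\<zeta> * v)))"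
      using elim by simp
    then show ?case
      using elim cone_eq_iff[OF b', of "H (t *\<^sub>R v)" "H (t *\<^sub>R (\<zeta> * v))"] by auto
  qed
  then have freqR: "\<exists>\<^sub>F t::real in at 0. \<exists>\<zeta>'\<in>?R. H (t *\<^sub>R (\<zeta> * v)) = \<zeta>' * H (t *\<^sub>R v)"
    by (rule eventually_frequently[rotated]) simp
  have "finite ?R"
    using cone_order[OF b'] by (intro finite_roots_unity) simp
  from frequently_bex_finite[OF this freqR]
  obtain \<zeta>' where \<zeta>': "\<zeta>' ^ m' = 1"
    and freq: "\<exists>\<^sub>F t::real in at 0. H (t *\<^sub>R (\<zeta> * v)) = \<zeta>' * H (t *\<^sub>R v)"
    by blast
  define D where "D t = H (t *\<^sub>R (\<zeta> * v)) - \<zeta>' * H (t *\<^sub>R v)" for t :: real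
  define d where "d = L (\<zeta> * v) - \<zeta>' * L v"
  have freqD: "\<exists>\<^sub>F t in at 0. D t = 0"
    using freq by (simp add: D_def)
  have lin: "linear L"
    using H by (rule has_derivative_linear)
  have Hu: "((\<lambda>t::real. H (t *\<^sub>R u)) has_derivative (\<lambda>t. L (t *\<^sub>R u))) (at 0)" for u
    by (rule has_derivative_compose[of "\<lambda>t. t *\<^sub>R u"])
       (use H in \<open>auto intro!: derivative_eq_intros\<close>)
  have "(D has_derivative (\<lambda>t. L (t *\<^sub>R (\<zeta> * v)) - \<zeta>' * L (t *\<^sub>R v))) (at 0)"
    unfolding D_def[abs_def] by (intro has_derivative_diff has_derivative_mult_right Hu)
  also have "(\<lambda>t. L (t *\<^sub>R (\<zeta> * v)) - \<zeta>' * L (t *\<^sub>R v)) = (\<lambda>t. t *\<^sub>R d)"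
    unfolding linear_scale[OF lin] d_def by (simp add: scaleR_diff_right)
  finally have D: "(D has_derivative (\<lambda>t. t *\<^sub>R d)) (at 0)" .
  have "(D \<longlongrightarrow> D 0) (at 0)"
    using has_derivative_continuous[OF D] by (simp add: continuous_within)
  then have D0: "D 0 = 0"
    using freqD by (rule limit_frequently_const)
  \<comment> \<open>The difference quotient of \<open>D\<close> is frequently \<open>0\<close>, so its distance from the limit \<open>d\<close> is frequently \<open>norm d\<close>.\<close>
  have "((\<lambda>t. norm (D t - D 0 - t *\<^sub>R d) / norm t) \<longlongrightarrow> 0) (at 0)"
    using D by (simp add: has_derivative_at)
  moreover have "\<exists>\<^sub>F t in at 0. norm (D t - D 0 - t *\<^sub>R d) / norm t = norm d"
  proof -
    have "\<forall>\<^sub>F t::real in at 0. t \<noteq> 0"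
      by (simp add: eventually_at_filter)
    from frequently_eventually_conj[OF freqD this] show ?thesis
      by (rule frequently_elim1) (simp add: D0)
  qed
  ultimately have "0 = norm d"
    by (rule limit_frequently_const)
  then have "L (\<zeta> * v) = \<zeta>' * L v"
    by (simp add: d_def)
  moreover have "\<zeta>' * H 0 = H 0"
    using D0 by (simp add: D_def)
  ultimately show ?thesis
    using that \<zeta>' by blast
qed

text \<open>
  The isotropy group of the image point is trivial unless \<open>x' = 0\<close>, and then it has order \<open>m'\<close>. The
  derivative of the lift maps the \<open>m\<close>-th roots of unity injectively into the orbit of one vector under
  this group.
\<close>

lemma isotropy_order_le:
  assumes f: "smooth_orbifold_map X (spindle_atlas p q) X (spindle_atlas p q) f"
    and area: "area_preserving p q f"
    and b: "(b, m, \<rho>) \<in> cone_charts p q" and b': "(b', m', \<rho>') \<in> cone_charts p q"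
    and x': "x' \<in> ball 0 1" and fx: "f (cmap b 0) = cmap b' x'"
  shows "x' = 0 \<and> m \<le> m'"
proof -
  have z: "0 \<in> ball (0 :: complex) 1" by simp
  obtain H L where H: "H 0 = x'" "(H has_derivative L) (at 0)" and jac: "\<rho>' x' * jacobian L = \<rho> 0"
    and lift: "\<forall>\<^sub>F w in nhds 0. w \<in> ball 0 1 \<and> H w \<in> ball 0 1 \<and> cmap b' (H w) = f (cmap b w)"
    by (rule area_preserving_lift[OF f area b b' z x' fx])
  have lin: "linear L"
    using H(2) by (rule has_derivative_linear)
  have j0: "jacobian L \<noteq> 0"
    using jac cone_density_pos[OF b z] by auto
  have inj: "u = w" if "L u = L w" for u w
  proof -
    have "L (u - w) = 0"
      using linear_diff[OF lin, of u w] that by simp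
    then have "signed_area (L (u - w)) (L (\<i> * (u - w))) = 0"
      by (simp add: signed_area_def)
    then have "signed_area (u - w) (\<i> * (u - w)) = 0"
      using j0 by (simp add: signed_area_linear[OF lin])
    then have "(Re (u - w))\<^sup>2 + (Im (u - w))\<^sup>2 = 0"
      by (simp add: signed_area_def power2_eq_square algebra_simps)
    then show "u = w"
      by (simp add: sum_power2_eq_zero_iff complex_eq_iff)
  qed
  define R where "R = {\<zeta>' :: complex. \<zeta>' ^ m' = 1 \<and> \<zeta>' * x' = x'}"
  have finR: "finite R"
    using cone_order[OF b'] finite_roots_unity[of m'] by (auto simp: R_def intro: rev_finite_subset)
  have "L ` {\<zeta>. \<zeta> ^ m = 1} \<subseteq> (\<lambda>\<zeta>'. \<zeta>' * L 1) ` R"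
  proof
    fix y assume "y \<in> L ` {\<zeta>. \<zeta> ^ m = 1}"
    then obtain \<zeta> where \<zeta>: "\<zeta> ^ m = 1" "y = L \<zeta>" by blast
    obtain \<zeta>' where "\<zeta>' ^ m' = 1" "\<zeta>' * H 0 = H 0" "L (\<zeta> * 1) = \<zeta>' * L 1"
      by (rule lift_derivative_intertwines[OF b b' H(2) lift \<zeta>(1)])
    then show "y \<in> (\<lambda>\<zeta>'. \<zeta>' * L 1) ` R"
      using \<zeta>(2) H(1) by (auto simp: R_def)
  qed
  then have "card (L ` {\<zeta>. \<zeta> ^ m = 1}) \<le> card ((\<lambda>\<zeta>'. \<zeta>' * L 1) ` R)"
    using finR by (intro card_mono) auto
  also have "\<dots> \<le> card R"
    using finR by (rule card_image_le)
  also have "card (L ` {\<zeta>. \<zeta> ^ m = 1}) = card {\<zeta> :: complex. \<zeta> ^ m = 1}"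
    using inj by (intro card_image) (auto simp: inj_on_def)
  also have "\<dots> = m"
    using cone_order[OF b] by (intro card_roots_unity_eq) simp
  finally have le: "m \<le> card R" .
  show ?thesis
  proof (cases "x' = 0")
    case True
    then have "card R = m'"
      using cone_order[OF b'] card_roots_unity_eq[of m'] by (simp add: R_def)
    with True le show ?thesis by simp
  next
    case False
    then have "R \<subseteq> {1}" by (auto simp: R_def)
    then have "card R \<le> 1"
      using card_mono[of "{1::complex}" R] by simp
    then show ?thesis
      using le cone_order[OF b] by simp
  qed
qed

text \<open>
  A cone point goes to a cone point of at least the same order; the alternative to fixing both is to
  exchange them, which would force \<open>p = q\<close>.
\<close>

lemma area_preserving_fixes_poles:
  assumes f: "smooth_orbifold_map X (spindle_atlas p q) X (spindle_atlas p q) f"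
    and area: "area_preserving p q f" and inj: "inj_on f (topspace X)"
  shows "f pole_N = pole_N" "f pole_S = pole_S"
proof -
  have into: "f x \<in> topspace X" if "x \<in> topspace X" for x
    using f that by (auto simp: smooth_orbifold_map_def continuous_map_def)
  have step: "(f (cmap b 0) = pole_N \<and> m \<le> q) \<or> (f (cmap b 0) = pole_S \<and> m \<le> p)"
    if b: "(b, m, \<rho>) \<in> cone_charts p q" for b m \<rho>
  proof -
    have "cmap b 0 \<in> topspace X"
      using cone_continuous[OF b] by (auto simp: continuous_map_def)
    then obtain b' m' \<rho>' x' where b': "(b', m', \<rho>') \<in> cone_charts p q"
      and x': "x' \<in> ball 0 1" "cmap b' x' = f (cmap b 0)"
      using cone_cover into by metis
    have "x' = 0 \<and> m \<le> m'"
      using isotropy_order_le[OF f area b b' x'(1) x'(2)[symmetric]] .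
    then show ?thesis
      using b' x'(2) by (auto simp: cone_charts_def)
  qed
  have N: "(f pole_N = pole_N \<and> q \<le> q) \<or> (f pole_N = pole_S \<and> q \<le> p)"
    by (rule step[of _ _ "area_density p q"]) (simp add: cone_charts_def)
  have S: "(f pole_S = pole_N \<and> p \<le> q) \<or> (f pole_S = pole_S \<and> p \<le> p)"
    by (rule step[of _ _ "area_density q p"]) (simp add: cone_charts_def)
  have ne: "f pole_N \<noteq> f pole_S"
    using inj_onD[OF inj _ poles_in_topspace] poles_distinct by blast
  have "p \<noteq> q"
    using cop p2 by auto
  then show "f pole_N = pole_N" "f pole_S = pole_S"
    using N S ne by auto
qed

end

section \<open>Invariant densities in the plane\<close>

text \<open>
  The change of variables formula is about \<open>real^2\<close>; all integrals are therefore taken there, over images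
  of sets of complex numbers.
\<close>

definition plane_vec :: "complex \<Rightarrow> real^2" where
  "plane_vec z = vector [Re z, Im z]"

definition plane_complex :: "real^2 \<Rightarrow> complex" where
  "plane_complex a = Complex (a $ 1) (a $ 2)"

lemma plane_complex_plane_vec [simp]: "plane_complex (plane_vec z) = z"
  by (simp add: plane_complex_def plane_vec_def)

lemma plane_vec_plane_complex [simp]: "plane_vec (plane_complex a) = a"
  by (simp add: plane_complex_def plane_vec_def vec_eq_iff forall_2)

lemma linear_plane_vec: "linear plane_vec"
  by (intro linearI) (simp_all add: plane_vec_def vec_eq_iff forall_2)

lemma linear_plane_complex: "linear plane_complex"
  by (intro linearI) (simp_all add: plane_complex_def complex_eq_iff)

lemma det_plane_conjugate:
  "det (matrix (\<lambda>a. plane_vec (L (plane_complex a)))) = jacobian L"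
proof -
  have "plane_complex (axis 1 1) = 1" "plane_complex (axis 2 1) = \<i>"
    by (simp_all add: plane_complex_def axis_def complex_eq_iff)
  then show ?thesis
    by (simp add: det_2 matrix_def jacobian_def signed_area_def plane_vec_def)
qed

lemma plane_image_eq: "plane_vec ` S = plane_complex -` S"
proof (intro equalityI subsetI)
  fix a assume "a \<in> plane_complex -` S"
  then have "plane_vec (plane_complex a) \<in> plane_vec ` S" by blast
  then show "a \<in> plane_vec ` S" by simp
qed auto

lemma open_plane_image:
  assumes "open S"
  shows "open (plane_vec ` S)"
  unfolding plane_image_eq
  using linear_continuous_on[OF linear_conv_bounded_linear[THEN iffD1, OF linear_plane_complex], of UNIV]
    assms by (simp add: continuous_on_open_vimage)

lemma invariant_density_integral:
  fixes F :: "complex \<Rightarrow> complex" and \<delta> :: "complex \<Rightarrow> real"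
  assumes S: "open S" and der: "\<And>u. u \<in> S \<Longrightarrow> (F has_derivative M u) (at u)"
    and inj: "inj_on F S" and \<delta>: "\<And>u. u \<in> S \<Longrightarrow> \<bar>jacobian (M u)\<bar> * \<delta> (F u) = \<delta> u"
    and int: "(\<lambda>a. \<delta> (plane_complex a)) absolutely_integrable_on plane_vec ` S"
  shows "(\<lambda>a. \<delta> (plane_complex a)) absolutely_integrable_on plane_vec ` F ` S"
    and "integral (plane_vec ` F ` S) (\<lambda>a. \<delta> (plane_complex a)) =
         integral (plane_vec ` S) (\<lambda>a. \<delta> (plane_complex a))"
proof -
  define G where "G a = plane_vec (F (plane_complex a))" for a
  define M' where "M' a = (\<lambda>b. plane_vec (M (plane_complex a) (plane_complex b)))" for a
  \<comment> \<open>The formula is about vector valued integrands.\<close>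
  define f :: "real^2 \<Rightarrow> real^1" where "f a = vec (\<delta> (plane_complex a))" for a
  have leb: "plane_vec ` S \<in> sets lebesgue"
    using open_plane_image[OF S] by simp
  have derG: "(G has_derivative M' a) (at a within plane_vec ` S)" if "a \<in> plane_vec ` S" for a
  proof -
    have "plane_complex a \<in> S" using that by auto
    from der[OF this] have "(F has_derivative M (plane_complex a)) (at (plane_complex a))" .
    with linear_imp_has_derivative[OF linear_plane_complex]
    have "((\<lambda>a. F (plane_complex a)) has_derivative (\<lambda>b. M (plane_complex a) (plane_complex b)))
        (at a within plane_vec ` S)"
      by (rule has_derivative_compose)
    from has_derivative_compose[OF this linear_imp_has_derivative[OF linear_plane_vec]]
    show ?thesis unfolding G_def M'_def .
  qed
  have injG: "inj_on G (plane_vec ` S)"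
  proof (rule inj_onI)
    fix a b assume ab: "a \<in> plane_vec ` S" "b \<in> plane_vec ` S" "G a = G b"
    from arg_cong[OF ab(3), of plane_complex] have "F (plane_complex a) = F (plane_complex b)"
      by (simp add: G_def)
    then have "plane_complex a = plane_complex b"
      by (rule inj_onD[OF inj]) (use ab(1,2) in auto)
    from arg_cong[OF this, of plane_vec] show "a = b" by simp
  qed
  have eq: "\<bar>det (matrix (M' a))\<bar> *\<^sub>R f (G a) = f a" if "a \<in> plane_vec ` S" for a
  proof -
    have "det (matrix (M' a)) = jacobian (M (plane_complex a))"
      unfolding M'_def by (rule det_plane_conjugate)
    moreover have "plane_complex a \<in> S" using that by auto
    ultimately show ?thesis
      using \<delta>[of "plane_complex a"] by (simp add: f_def G_def vec_eq_iff)
  qed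
  have f1: "f a $ 1 = \<delta> (plane_complex a)" for a
    by (simp add: f_def)
  have intf: "f absolutely_integrable_on plane_vec ` S"
    using int by (simp add: absolutely_integrable_on_1_iff f1)
  have "(\<lambda>a. \<bar>det (matrix (M' a))\<bar> *\<^sub>R f (G a)) absolutely_integrable_on plane_vec ` S \<longleftrightarrow>
      f absolutely_integrable_on plane_vec ` S"
    using eq by (intro set_integrable_cong) auto
  moreover have "integral (plane_vec ` S) (\<lambda>a. \<bar>det (matrix (M' a))\<bar> *\<^sub>R f (G a)) = integral (plane_vec ` S) f"
    using eq by (intro integral_cong) auto
  ultimately have *: "f absolutely_integrable_on G ` plane_vec ` S \<and>
      integral (G ` plane_vec ` S) f = integral (plane_vec ` S) f"
    using has_absolute_integral_change_of_variables[OF leb derG injG, of f "integral (plane_vec ` S) f"] intf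
    by simp
  have G: "G ` plane_vec ` S = plane_vec ` F ` S"
    by (simp add: G_def image_image)
  show "(\<lambda>a. \<delta> (plane_complex a)) absolutely_integrable_on plane_vec ` F ` S"
    using * by (simp add: G absolutely_integrable_on_1_iff f1)
  show "integral (plane_vec ` F ` S) (\<lambda>a. \<delta> (plane_complex a)) =
         integral (plane_vec ` S) (\<lambda>a. \<delta> (plane_complex a))"
    using * by (simp add: G integral_on_1_eq f1 vec_eq_iff)
qed

text \<open>
  The difference of the two sets contains a box, over which a positive continuous function has a
  positive integral.
\<close>

lemma integral_strict_mono_open:
  fixes \<delta> :: "'a::euclidean_space \<Rightarrow> real"
  assumes int: "\<delta> absolutely_integrable_on Q" and P: "P \<in> sets lebesgue" "P \<subseteq> Q"
    and R: "open R" "R \<noteq> {}" "R \<subseteq> Q - P"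
    and cont: "continuous_on R \<delta>" and pos: "\<And>x. x \<in> Q \<Longrightarrow> \<delta> x > 0"
  shows "integral P \<delta> < integral Q \<delta>"
proof -
  obtain a b where ab: "cbox a b \<subseteq> R" "box a b \<noteq> {}"
    using R(1,2) by (metis all_not_in_conv open_contains_cbox)
  have intP: "\<delta> integrable_on P"
    using set_integrable_subset[OF int P] by (rule absolutely_integrable_on_def[THEN iffD1, THEN conjunct1])
  have cont': "continuous_on (cbox a b) \<delta>"
    using cont ab(1) by (rule continuous_on_subset)
  then have intc: "\<delta> integrable_on cbox a b"
    by (rule integrable_continuous)
  have posc: "\<delta> x > 0" if "x \<in> cbox a b" for x
    using pos R(3) ab(1) that by blast
  have "integral (cbox a b) \<delta> \<noteq> 0"
  proof
    assume "integral (cbox a b) \<delta> = 0"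
    then have "\<forall>x\<in>cbox a b. \<delta> x = 0"
      using integral_cbox_eq_0_iff[OF cont' ab(2)] posc by (simp add: less_imp_le)
    then show False
      using posc ab(2) box_subset_cbox[of a b] by fastforce
  qed
  moreover have "integral (cbox a b) \<delta> \<ge> 0"
    using posc by (intro integral_nonneg[OF intc]) (simp add: less_imp_le)
  moreover have "integral (P \<union> cbox a b) \<delta> = integral P \<delta> + integral (cbox a b) \<delta>"
  proof -
    have "P \<inter> cbox a b = {}" using R(3) ab(1) by blast
    then show ?thesis by (intro integral_Un intP intc) simp
  qed
  moreover have "integral (P \<union> cbox a b) \<delta> \<le> integral Q \<delta>"
  proof (rule integral_subset_le)
    show "P \<union> cbox a b \<subseteq> Q" using P(2) R(3) ab(1) by blast
    have "P \<inter> cbox a b = {}" using R(3) ab(1) by blast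
    then show "\<delta> integrable_on P \<union> cbox a b"
      by (intro integrable_Un intP intc) simp
    show "\<delta> integrable_on Q"
      using int by (rule absolutely_integrable_on_def[THEN iffD1, THEN conjunct1])
  qed (use pos in \<open>auto simp: less_imp_le\<close>)
  ultimately show ?thesis by linarith
qed

lemma absolutely_integrable_continuous_compact_subset:
  fixes f :: "'a::euclidean_space \<Rightarrow> real"
  assumes "compact K" "continuous_on K f" "P \<in> sets lebesgue" "P \<subseteq> K"
  shows "f absolutely_integrable_on P"
proof -
  have "set_integrable lebesgue K f"
    using borel_integrable_compact[OF assms(1,2)] unfolding set_integrable_def
    by (intro integrable_completion[THEN iffD2]) (auto simp: borel_measurable_integrable)
  then show ?thesis
    using assms(3,4) by (rule set_integrable_subset)
qed

text \<open>
  A local branch of the \<open>n\<close>-th root through a prescribed root, obtained by rescaling the principal branch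
  to be centred at \<open>1\<close>.
\<close>

lemma local_power_root:
  fixes z :: complex
  assumes "n > 0" "z \<noteq> 0"
  obtains \<omega> where "\<omega> (z ^ n) = z" "(\<omega> has_field_derivative z / (of_nat n * z ^ n)) (at (z ^ n))"
    "\<forall>\<^sub>F u in nhds (z ^ n). \<omega> u ^ n = u"
proof -
  define \<omega> where "\<omega> = (\<lambda>u. z * exp (Ln (u / z ^ n) / of_nat n))"
  have zn: "z ^ n \<noteq> 0" using assms by simp
  have val: "\<omega> (z ^ n) = z"
    using zn by (simp add: \<omega>_def)
  have "z ^ n / z ^ n \<notin> \<real>\<^sub>\<le>\<^sub>0"
    using zn by simp
  then have deriv: "(\<omega> has_field_derivative z / (of_nat n * z ^ n)) (at (z ^ n))"
    unfolding \<omega>_def using zn assms by (auto intro!: derivative_eq_intros simp: field_simps)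
  have "\<forall>\<^sub>F u in nhds (z ^ n). u \<noteq> 0"
    using t1_space_nhds[of "z ^ n" 0] zn by simp
  then have root: "\<forall>\<^sub>F u in nhds (z ^ n). \<omega> u ^ n = u"
  proof eventually_elim
    case (elim u)
    have "exp (Ln (u / z ^ n) / of_nat n) ^ n = exp (Ln (u / z ^ n))"
      using assms(1) by (simp add: exp_of_nat_mult[symmetric])
    then show ?case
      using elim zn by (simp add: \<omega>_def power_mult_distrib)
  qed
  from val deriv root show ?thesis by (rule that)
qed

section \<open>The map in a global coordinate\<close>

context spindle_weights
begin

text \<open>
  The coordinate \<open>u = z\<^sup>q\<close> of the quotient of the chart around \<open>N\<close> by its group. The value does not depend
  on the point \<open>z\<close> chosen over \<open>x\<close>, by \<open>coord_proj_N\<close> below.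
\<close>

definition coord :: "(complex \<times> complex) set \<Rightarrow> complex" where
  "coord x = (SOME z. z \<in> ball 0 1 \<and> proj_N z = x) ^ q"

definition regular_part :: "(complex \<times> complex) set set" where
  "regular_part = topspace X - {pole_N, pole_S}"

definition coord_image :: "(complex \<times> complex) set set \<Rightarrow> complex set" where
  "coord_image U = coord ` (U \<inter> regular_part)"

text \<open>
  The density of the area in the coordinate \<open>u\<close>: that of the chart at a point \<open>z\<close> with \<open>z\<^sup>q = u\<close>, divided
  by the Jacobian \<open>\<bar>q z\<^sup>q\<^sup>-\<^sup>1\<bar>\<^sup>2\<close> of the power map. Both depend on \<open>\<bar>z\<bar>\<close> only.
\<close>

definition coord_density :: "complex \<Rightarrow> real" where
  "coord_density u = area_density p q (complex_of_real (root q (cmod u))) /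
     (real q * root q (cmod u) ^ (q - 1))\<^sup>2"

lemma cone_N: "(chart_N p q, q, area_density p q) \<in> cone_charts p q"
  by (simp add: cone_charts_def)

lemma coord_proj_N:
  assumes "z \<in> ball 0 1"
  shows "coord (proj_N z) = z ^ q"
proof -
  let ?w = "SOME w. w \<in> ball 0 1 \<and> proj_N w = proj_N z"
  have "?w \<in> ball 0 1 \<and> proj_N ?w = proj_N z"
    using assms by (intro someI[of "\<lambda>w. w \<in> ball 0 1 \<and> proj_N w = proj_N z" z]) simp
  then obtain \<zeta> where "\<zeta> ^ q = 1" "z = \<zeta> * ?w"
    using cone_eq_iff[OF cone_N _ assms, of ?w] by blast
  then have "z ^ q = ?w ^ q"
    by (metis mult_1 power_mult_distrib)
  then show ?thesis
    unfolding coord_def by (rule sym)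
qed

lemma regular_part_eq: "regular_part = proj_N ` (ball 0 1 - {0})"
proof -
  have "proj_N z \<in> {pole_N, pole_S} \<longleftrightarrow> z = 0" if "z \<in> ball 0 1" for z
    using cone_eq_pole_iff[OF cone_N that] .
  then show ?thesis
    unfolding regular_part_def topspace_eq by blast
qed

lemma coord_inj: "inj_on coord regular_part"
proof (rule inj_onI)
  fix x y assume "x \<in> regular_part" "y \<in> regular_part" and eq: "coord x = coord y"
  then obtain z w where z: "z \<in> ball 0 1" "z \<noteq> 0" "x = proj_N z" and w: "w \<in> ball 0 1" "y = proj_N w"
    unfolding regular_part_eq by blast
  have "w ^ q = z ^ q"
    using eq by (simp only: z(3) w(2) coord_proj_N[OF z(1)] coord_proj_N[OF w(1)])
  then have "(w / z) ^ q = 1" "w = (w / z) * z"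
    using z(2) by (simp_all add: power_divide)
  then have "proj_N z = proj_N w"
    using cone_eq_iff[OF cone_N z(1) w(1)] by blast
  then show "x = y" using z(3) w(2) by simp
qed

text \<open>
  Near \<open>u = z\<^sup>q\<close>, a continuous local \<open>q\<close>-th root brings points back to the chart, near \<open>z\<close>.
\<close>

lemma open_coord_image:
  assumes U: "openin X U"
  shows "open (coord_image U)"
proof (subst open_subopen, intro ballI)
  fix u assume "u \<in> coord_image U"
  then obtain x where x: "x \<in> U" "x \<in> regular_part" "u = coord x"
    unfolding coord_image_def by blast
  then obtain z where z: "z \<in> ball 0 1" "z \<noteq> 0" "x = proj_N z"
    unfolding regular_part_eq by blast
  have zU: "proj_N z \<in> U" and uz: "u = z ^ q"
    using x z coord_proj_N[OF z(1)] by simp_all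
  obtain \<omega> where \<omega>: "\<omega> (z ^ q) = z" "(\<omega> has_field_derivative z / (of_nat q * z ^ q)) (at (z ^ q))"
    and root: "\<forall>\<^sub>F u in nhds (z ^ q). \<omega> u ^ q = u"
    using local_power_root[OF q0 z(2)] .
  define V where "V = {w \<in> ball 0 1. proj_N w \<in> U} - {0}"
  have "openin (top_of_set (ball 0 1)) {w \<in> ball 0 1. proj_N w \<in> U}"
    using cone_continuous[OF cone_N] U by (auto simp: continuous_map_def)
  then have "open V"
    unfolding V_def using openin_open_eq[of "ball (0::complex) 1"] by (intro open_Diff) auto
  moreover have "z \<in> V"
    using z zU by (simp add: V_def)
  moreover have "(\<omega> \<longlongrightarrow> z) (nhds (z ^ q))"
    using DERIV_isCont[OF \<omega>(2)] tendsto_at_iff_tendsto_nhds[of \<omega> "z ^ q"]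
    by (simp add: isCont_def \<omega>(1))
  ultimately have "\<forall>\<^sub>F u in nhds (z ^ q). \<omega> u \<in> V"
    by (rule topological_tendstoD[rotated 1])
  with root have "\<forall>\<^sub>F u in nhds (z ^ q). u \<in> coord_image U"
  proof eventually_elim
    case (elim v)
    then have "\<omega> v \<in> ball 0 1" "\<omega> v \<noteq> 0" "proj_N (\<omega> v) \<in> U"
      by (auto simp: V_def)
    then show ?case
      unfolding coord_image_def regular_part_eq using coord_proj_N[of "\<omega> v"] elim(1)
      by (intro image_eqI[of _ _ "proj_N (\<omega> v)"]) auto
  qed
  then show "\<exists>T. open T \<and> u \<in> T \<and> T \<subseteq> coord_image U"
    unfolding eventually_nhds uz by auto
qed

lemma area_density_cmod: "area_density p q (complex_of_real (cmod z)) = area_density p q z"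
  by (simp add: area_density_def)

lemma coord_density_power:
  "coord_density (z ^ q) = area_density p q z / (cmod (of_nat q * z ^ (q - 1)))\<^sup>2"
  using q0 by (simp add: coord_density_def norm_power norm_mult real_root_power_cancel area_density_cmod)

lemma coord_density_pos:
  assumes "u \<noteq> 0" "cmod u \<le> 1"
  shows "coord_density u > 0"
proof -
  have "root q (cmod u) > 0" "root q (cmod u) \<le> 1"
    using assms q0 by simp_all
  then show ?thesis
    unfolding coord_density_def using q0 area_density_pos[of "complex_of_real (root q (cmod u))" p q] p0
    by (intro divide_pos_pos zero_less_power mult_pos_pos) simp_all
qed

lemma continuous_on_coord_density: "continuous_on (cball 0 1 - {0}) coord_density"
proof -
  have r: "root q (cmod u) > 0" "root q (cmod u) \<le> 1" if "u \<in> cball 0 1 - {0}" for u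
    using that q0 by simp_all
  have "(real p)\<^sup>2 * (cmod (complex_of_real (root q (cmod u))))\<^sup>2 +
      (real q)\<^sup>2 * (1 - (cmod (complex_of_real (root q (cmod u))))\<^sup>2) \<noteq> 0" if "u \<in> cball 0 1 - {0}" for u
    using area_density_radicand_pos[of "complex_of_real (root q (cmod u))" p q] p0 q0 r[OF that]
    by simp
  moreover have "real q * root q (cmod u) ^ (q - 1) \<noteq> 0" if "u \<in> cball 0 1 - {0}" for u
    using r[OF that] q0 by simp
  ultimately show ?thesis
    unfolding coord_density_def[abs_def] area_density_def
    by (intro continuous_intros) auto
qed

definition coord_map :: "((complex \<times> complex) set \<Rightarrow> (complex \<times> complex) set) \<Rightarrow> complex \<Rightarrow> complex" where
  "coord_map f u = coord (f (inv_into regular_part coord u))"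

lemma coord_map_coord: "x \<in> regular_part \<Longrightarrow> coord_map f (coord x) = coord (f x)"
  by (simp add: coord_map_def inv_into_f_f[OF coord_inj])

text \<open>
  Near \<open>u = z\<^sup>q\<close> the map is the \<open>q\<close>-th power of the lift of \<open>f\<close> at \<open>z\<close>, composed with a local
  \<open>q\<close>-th root. The Jacobians of power and root are cancelled by the denominators in the density.
\<close>

lemma coord_map_derivative:
  assumes f: "smooth_orbifold_map X (spindle_atlas p q) X (spindle_atlas p q) f"
    and area: "area_preserving p q f"
    and reg: "\<And>x. x \<in> regular_part \<Longrightarrow> f x \<in> regular_part"
    and u: "u \<in> coord ` regular_part"
  obtains M where "(coord_map f has_derivative M) (at u)"
    "jacobian M * coord_density (coord_map f u) = coord_density u" "jacobian M \<ge> 0"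
proof -
  obtain x where x: "x \<in> regular_part" "u = coord x" using u by blast
  obtain z where z: "z \<in> ball 0 1" "z \<noteq> 0" "x = proj_N z"
    using x(1) unfolding regular_part_eq by blast
  obtain w where w: "w \<in> ball 0 1" "w \<noteq> 0" "f x = proj_N w"
    using reg[OF x(1)] unfolding regular_part_eq by blast
  have uz: "u = z ^ q"
    unfolding x(2) z(3) by (rule coord_proj_N[OF z(1)])
  have Fu: "coord_map f u = w ^ q"
    unfolding x(2) coord_map_coord[OF x(1)] w(3) by (rule coord_proj_N[OF w(1)])
  obtain H L where H: "H z = w" "(H has_derivative L) (at z)"
    and jac: "area_density p q w * jacobian L = area_density p q z"
    and lift: "\<forall>\<^sub>F v in nhds z. v \<in> ball 0 1 \<and> H v \<in> ball 0 1 \<and> proj_N (H v) = f (proj_N v)"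
    by (rule area_preserving_lift[OF f area cone_N cone_N z(1) w(1) w(3)[unfolded z(3)]])
  define D where "D = z / (of_nat q * z ^ q)"
  obtain \<omega> where \<omega>: "\<omega> u = z" "(\<omega> has_field_derivative D) (at u)"
    and root: "\<forall>\<^sub>F v in nhds u. \<omega> v ^ q = v"
    using local_power_root[OF q0 z(2)] unfolding uz D_def .
  define E where "E = of_nat q * w ^ (q - 1)"
  define M where "M = (\<lambda>v. E * L (D * v))"
  have \<omega>z: "(\<omega> \<longlongrightarrow> z) (nhds u)"
    using DERIV_isCont[OF \<omega>(2)] tendsto_at_iff_tendsto_nhds[of \<omega> u]
    by (simp add: isCont_def \<omega>(1))
  have ev: "\<forall>\<^sub>F v in nhds u. H (\<omega> v) ^ q = coord_map f v"
    using root eventually_compose_filterlim[OF lift \<omega>z]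
      tendsto_imp_eventually_ne[OF \<omega>z z(2)]
  proof eventually_elim
    case (elim v)
    then have v: "\<omega> v \<in> ball 0 1 - {0}" by simp
    have "proj_N (\<omega> v) \<in> regular_part"
      unfolding regular_part_eq using v by (rule imageI)
    from coord_map_coord[OF this, of f]
    have "coord_map f (coord (proj_N (\<omega> v))) = coord (proj_N (H (\<omega> v)))"
      using elim by simp
    then show ?case
      using coord_proj_N[of "\<omega> v"] coord_proj_N[of "H (\<omega> v)"] elim by simp
  qed
  have "((\<lambda>v. H (\<omega> v) ^ q) has_derivative M) (at u)"
  proof -
    have "(H has_derivative L) (at (\<omega> u))" using H(2) \<omega>(1) by simp
    from has_derivative_compose[OF has_field_derivative_imp_has_derivative[OF \<omega>(2)] this]
    have "((\<lambda>v. H (\<omega> v)) has_derivative (\<lambda>v. L (D * v))) (at u)" .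
    from has_derivative_power[OF this, of q] show ?thesis
      by (simp add: M_def E_def \<omega>(1) H(1) mult_ac)
  qed
  then have DF: "(coord_map f has_derivative M) (at u)"
  proof (rule has_derivative_transform_eventually)
    show "\<forall>\<^sub>F v in at u. H (\<omega> v) ^ q = coord_map f v"
      unfolding eventually_at_filter using ev by (rule eventually_mono) simp
    show "H (\<omega> u) ^ q = coord_map f u"
      using eventually_nhds_x_imp_x[OF ev] .
  qed simp
  have L: "linear L" using H(2) by (rule has_derivative_linear)
  have "M = (\<lambda>v. E * v) \<circ> (L \<circ> (\<lambda>v. D * v))"
    by (simp add: M_def o_def)
  moreover have "linear (\<lambda>v. E * v)"
    by (intro linearI) (simp_all add: algebra_simps)
  ultimately have jM: "jacobian M = (cmod E)\<^sup>2 * (jacobian L * (cmod D)\<^sup>2)"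
    by (simp only: jacobian_compose L jacobian_mult)
  have \<rho>: "area_density p q w > 0" "area_density p q z > 0"
    using z w cone_density_pos[OF cone_N] by auto
  have E0: "cmod E \<noteq> 0"
    using w(2) q0 by (simp add: E_def)
  have "z ^ q = z * z ^ (q - 1)"
    using q0 by (metis power_minus_mult mult.commute)
  then have D: "cmod D = 1 / cmod (of_nat q * z ^ (q - 1))"
    using z(2) q0 by (simp add: D_def norm_divide norm_mult)
  have "jacobian M * coord_density (w ^ q) = (jacobian L * area_density p q w) * (cmod D)\<^sup>2"
    unfolding coord_density_power jM E_def[symmetric] using E0 by simp
  also have "\<dots> = coord_density (z ^ q)"
    unfolding coord_density_power D using jac by (simp add: mult.commute power_divide)
  finally have 1: "jacobian M * coord_density (coord_map f u) = coord_density u"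
    unfolding Fu unfolding uz .
  have "jacobian L = area_density p q z / area_density p q w"
    using jac \<rho> by (simp add: field_simps)
  then have "jacobian M \<ge> 0"
    unfolding jM using \<rho> by simp
  with DF 1 show ?thesis by (rule that)
qed

lemma coord_image_subset: "coord_image U \<subseteq> cball 0 1 - {0}"
proof
  fix u assume "u \<in> coord_image U"
  then obtain z where z: "z \<in> ball 0 1 - {0}" "u = coord (proj_N z)"
    unfolding coord_image_def regular_part_eq by blast
  then have "u = z ^ q" using coord_proj_N[of z] by simp
  then show "u \<in> cball 0 1 - {0}"
    using z(1) by (simp add: norm_power power_le_one)
qed

lemma openin_meets_regular_part:
  assumes "openin X U" "U \<noteq> {}"
  shows "U \<inter> regular_part \<noteq> {}"
proof
  assume "U \<inter> regular_part = {}"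
  then have sub: "U \<subseteq> {pole_N, pole_S}"
    using openin_subset[OF assms(1)] by (auto simp: regular_part_def)
  then have "closedin X U"
    using closedin_Hausdorff_finite[OF Hausdorff_spindle[OF cop p0 q0] openin_subset[OF assms(1)]]
    by (simp add: finite_subset)
  then have "U = topspace X"
    using connected_spindle[of p q] assms unfolding connected_space_clopen_in by blast
  moreover have "proj_N (1 / 2) \<in> regular_part"
    unfolding regular_part_eq by (rule imageI) simp
  ultimately show False
    using sub unfolding regular_part_def by blast
qed

text \<open>
  The set \<open>B\<close> and its image have the same area; the density is integrable over \<open>B\<close> because \<open>B\<close> stays
  away from \<open>N\<close>, near which the density is unbounded. A nonempty open set has positive area, so neither of the two sets
  contains the other together with such a set \<open>K\<close>.
\<close>

lemma area_obstruction:
  assumes f: "smooth_orbifold_map X (spindle_atlas p q) X (spindle_atlas p q) f"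
    and area: "area_preserving p q f" and inj: "inj_on f (topspace X)"
    and A: "openin X A" "pole_N \<in> A" and B: "openin X B" "A \<inter> B = {}"
    and fB: "openin X (f ` B)" and K: "openin X K" "K \<noteq> {}"
  shows "\<not> (B \<subseteq> f ` B \<and> K \<subseteq> f ` B - B)" and "\<not> (f ` B \<subseteq> B \<and> K \<subseteq> B - f ` B)"
proof -
  note f_poles = area_preserving_fixes_poles[OF f area inj]
  have into: "f x \<in> topspace X" if "x \<in> topspace X" for x
    using f that by (auto simp: smooth_orbifold_map_def continuous_map_def)
  have f_reg: "f x \<in> regular_part" if x: "x \<in> regular_part" for x
  proof -
    have "f x \<noteq> f pole_N" "f x \<noteq> f pole_S"
      using x inj_onD[OF inj, of x pole_N] inj_onD[OF inj, of x pole_S] poles_in_topspace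
      by (auto simp: regular_part_def)
    then show ?thesis
      using x into f_poles by (auto simp: regular_part_def)
  qed
  have BX: "B \<subseteq> topspace X" by (rule openin_subset[OF B(1)])
  have image: "coord_image (f ` B) = coord_map f ` coord_image B"
  proof -
    have "f ` B \<inter> regular_part = f ` (B \<inter> regular_part)"
      using f_reg f_poles BX by (auto simp: regular_part_def)
    then show ?thesis
      unfolding coord_image_def image_image by (simp add: image_image coord_map_coord)
  qed
  define S where "S = coord_image B"
  have sub: "S \<subseteq> coord ` regular_part"
    by (auto simp: S_def coord_image_def)
  define M where "M u = (SOME M. (coord_map f has_derivative M) (at u) \<and>
    jacobian M * coord_density (coord_map f u) = coord_density u \<and> jacobian M \<ge> 0)" for u
  have M: "(coord_map f has_derivative M u) (at u) \<and>
    jacobian (M u) * coord_density (coord_map f u) = coord_density u \<and> jacobian (M u) \<ge> 0"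
    if u: "u \<in> S" for u
  proof -
    have "u \<in> coord ` regular_part" using sub u by blast
    from coord_map_derivative[OF f area f_reg this]
    have "\<exists>M. (coord_map f has_derivative M) (at u) \<and>
      jacobian M * coord_density (coord_map f u) = coord_density u \<and> jacobian M \<ge> 0"
      by blast
    then show ?thesis unfolding M_def by (rule someI_ex)
  qed
  have injF: "inj_on (coord_map f) S"
  proof (rule inj_onI)
    fix u v assume uv: "u \<in> S" "v \<in> S" "coord_map f u = coord_map f v"
    then obtain x y where x: "x \<in> regular_part" "u = coord x" and y: "y \<in> regular_part" "v = coord y"
      using sub by blast
    have "coord (f x) = coord (f y)"
      using uv(3) x y by (simp add: coord_map_coord)
    then have "f x = f y"
      by (rule inj_onD[OF coord_inj]) (use x y f_reg in auto)
    then have "x = y"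
      by (rule inj_onD[OF inj]) (use x y in \<open>auto simp: regular_part_def\<close>)
    then show "u = v" using x y by simp
  qed
  define \<delta> where "\<delta> a = coord_density (plane_complex a)" for a
  have cont: "continuous_on T \<delta>" if T: "plane_complex ` T \<subseteq> cball 0 1 - {0}" for T
    unfolding \<delta>_def using T linear_plane_complex
    by (intro continuous_on_compose2[OF continuous_on_coord_density] linear_continuous_on)
       (auto simp: linear_conv_bounded_linear)
  have pos: "\<delta> a > 0" if "a \<in> plane_vec ` coord_image U" for a U
  proof -
    have "plane_complex a \<in> cball 0 1 - {0}"
      using that coord_image_subset[of U] by auto
    then show ?thesis
      unfolding \<delta>_def by (intro coord_density_pos) auto
  qed
  have opn: "open (plane_vec ` coord_image U)" if "openin X U" for U
    using open_plane_image[OF open_coord_image[OF that]] .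
  have int: "\<delta> absolutely_integrable_on plane_vec ` S"
  proof -
    have "openin (top_of_set (ball 0 1)) {z \<in> ball 0 1. proj_N z \<in> A}"
      using cone_continuous[OF cone_N] A(1) by (auto simp: continuous_map_def)
    then have "open {z \<in> ball 0 1. proj_N z \<in> A}"
      using openin_open_eq[of "ball (0::complex) 1"] by auto
    moreover have "0 \<in> {z \<in> ball 0 1. proj_N z \<in> A}"
      using A(2) by simp
    ultimately obtain \<epsilon> where \<epsilon>: "\<epsilon> > 0" "ball 0 \<epsilon> \<subseteq> {z \<in> ball 0 1. proj_N z \<in> A}"
      using openE by blast
    \<comment> \<open>The disc of radius \<open>\<epsilon>\<close> lies over the neighbourhood \<open>A\<close> of \<open>N\<close>, which misses \<open>B\<close>.\<close>
    define T where "T = cball (0::complex) 1 - ball 0 (\<epsilon> ^ q)"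
    have T: "compact T" "T \<subseteq> cball 0 1 - {0}"
      using \<epsilon>(1) by (auto simp: T_def intro: compact_diff)
    have "S \<subseteq> T"
    proof
      fix u assume u: "u \<in> S"
      then obtain x where x: "x \<in> B" "x \<in> regular_part" "u = coord x"
        unfolding S_def coord_image_def by blast
      then obtain z where z: "z \<in> ball 0 1" "x = proj_N z"
        unfolding regular_part_eq by blast
      have "z \<notin> ball 0 \<epsilon>"
        using \<epsilon>(2) x(1) z B(2) by blast
      then have "\<epsilon> ^ q \<le> cmod z ^ q"
        using \<epsilon>(1) by (intro power_mono) auto
      then have "u \<notin> ball 0 (\<epsilon> ^ q)"
        using x(3) z coord_proj_N[OF z(1)] by (simp add: norm_power)
      then show "u \<in> T"
        using u coord_image_subset[of B] by (auto simp: S_def T_def)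
    qed
    moreover have "compact (plane_vec ` T)"
      using T(1) linear_plane_vec
      by (intro compact_continuous_image linear_continuous_on) (auto simp: linear_conv_bounded_linear)
    moreover have "continuous_on (plane_vec ` T) \<delta>"
      using T(2) by (intro cont) (auto simp: image_image)
    moreover have "plane_vec ` S \<in> sets lebesgue"
      using opn[OF B(1)] by (simp add: S_def)
    ultimately show ?thesis
      by (intro absolutely_integrable_continuous_compact_subset[of "plane_vec ` T"]) auto
  qed
  have "open S" unfolding S_def by (rule open_coord_image[OF B(1)])
  note transform = invariant_density_integral[of S "coord_map f" M coord_density, OF this _ injF, folded \<delta>_def]
  have int': "\<delta> absolutely_integrable_on plane_vec ` coord_image (f ` B)"
    unfolding image S_def[symmetric] by (rule transform(1)) (use M int in auto)
  have eq: "integral (plane_vec ` coord_image (f ` B)) \<delta> = integral (plane_vec ` S) \<delta>"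
    unfolding image S_def[symmetric] by (rule transform(2)) (use M int in auto)
  have coord_mono: "coord_image U \<subseteq> coord_image V" if "U \<subseteq> V" for U V
    using that by (auto simp: coord_image_def)
  have strict: "integral (plane_vec ` coord_image U) \<delta> < integral (plane_vec ` coord_image V) \<delta>"
    if intV: "\<delta> absolutely_integrable_on plane_vec ` coord_image V"
      and U: "openin X U" "U \<subseteq> V" "K \<subseteq> V - U" for U V
  proof (rule integral_strict_mono_open[OF intV])
    have inj_pc: "plane_vec a = plane_vec b \<longleftrightarrow> a = b" for a b
      by (metis plane_complex_plane_vec)
    have "coord_image K \<inter> coord_image U = {}"
      using U(3) inj_onD[OF coord_inj] unfolding coord_image_def by blast
    then show "plane_vec ` coord_image K \<subseteq> plane_vec ` coord_image V - plane_vec ` coord_image U"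
      using coord_mono[of K V] U(3) by (auto simp: inj_pc)
    show "plane_vec ` coord_image K \<noteq> {}"
      using openin_meets_regular_part[OF K] by (auto simp: coord_image_def)
    show "continuous_on (plane_vec ` coord_image K) \<delta>"
      using coord_image_subset[of K] by (intro cont) (auto simp: image_image)
    show "plane_vec ` coord_image U \<in> sets lebesgue"
      using opn[OF U(1)] by simp
  qed (use coord_mono[OF U(2)] pos opn[OF K(1)] in auto)
  show "\<not> (B \<subseteq> f ` B \<and> K \<subseteq> f ` B - B)"
    using strict[OF int' B(1)] eq unfolding S_def by auto
  show "\<not> (f ` B \<subseteq> B \<and> K \<subseteq> B - f ` B)"
    using strict[OF int[unfolded S_def] fB] eq unfolding S_def by auto
qed

end

section \<open>Displaced separators\<close>

text \<open>
  Let \<open>C\<close> separate \<open>X\<close> into \<open>A\<close> and \<open>B\<close>, let \<open>f\<close> fix a point of \<open>B\<close> and move \<open>C\<close> into \<open>A\<close>. The connected set \<open>B\<close>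
  avoids \<open>f(C)\<close> and meets \<open>f(B)\<close>, so it lies in \<open>f(B)\<close>. The connected set \<open>C\<close> lies in one of \<open>f(A)\<close> and \<open>f(B)\<close>; in
  the first case the roles of \<open>B\<close> and \<open>f(B)\<close> can be exchanged, so that they are equal. In that case \<open>B\<close>, and if
  \<open>f(B)\<close> misses \<open>A\<close> then \<open>f(B)\<close>, would be both open and closed.
\<close>

lemma displaced_separator_nested:
  assumes X: "connected_space X"
    and opn: "\<And>U. openin X U \<Longrightarrow> openin X (f ` U)" and cont: "continuous_map X X f"
    and inj: "inj_on f (topspace X)" and surj: "f ` topspace X = topspace X"
    and A: "openin X A" "A \<noteq> {}" and B: "openin X B" "connectedin X B" and C: "connectedin X C"
    and part: "topspace X = A \<union> B \<union> C" "A \<inter> B = {}" "A \<inter> C = {}" "B \<inter> C = {}"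
    and s: "s \<in> B" "f s = s" and fC: "f ` C \<subseteq> A"
  shows "B \<union> C \<subseteq> f ` B" and "f ` B \<inter> A \<noteq> {}"
proof -
  have sub: "A \<subseteq> topspace X" "B \<subseteq> topspace X" "C \<subseteq> topspace X"
    using part(1) by auto
  have fpart: "topspace X = f ` A \<union> f ` B \<union> f ` C"
    using surj part(1) by (simp add: image_Un)
  have fdisj: "f ` U \<inter> f ` V = {}" if "U \<inter> V = {}" "U \<subseteq> topspace X" "V \<subseteq> topspace X" for U V
    using inj_on_image_Int[OF inj that(2,3)] that(1) by simp
  note fAB = fdisj[OF part(2) sub(1,2)] and fAC = fdisj[OF part(3) sub(1,3)]
    and fBC = fdisj[OF part(4) sub(2,3)]
  have sfB: "s \<in> f ` B"
    using s by (metis imageI)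
  have clopen: "U = {} \<or> U = topspace X" if "openin X U" "closedin X U" for U
    using X that unfolding connected_space_clopen_in by blast
  have dichotomy: "S \<subseteq> U"
    if "connectedin X S" "openin X U" "openin X V" "S \<subseteq> U \<union> V" "U \<inter> V = {}" "S \<inter> U \<noteq> {}" for S U V
    using connectedinD[OF that(1-4)] that(4-6) by blast
  have BfB: "B \<subseteq> f ` B"
  proof (rule dichotomy[OF B(2) opn[OF B(1)] opn[OF A(1)]])
    show "B \<subseteq> f ` B \<union> f ` A"
      using fpart sub(2) fC part(2) by blast
  qed (use fAB s(1) sfB in auto)
  have CfB: "C \<subseteq> f ` B"
  proof (cases "C \<inter> f ` B = {}")
    case False
    show ?thesis
    proof (rule dichotomy[OF C opn[OF B(1)] opn[OF A(1)]])
      show "C \<subseteq> f ` B \<union> f ` A"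
        using fpart sub(3) fC part(3) by blast
    qed (use fAB False in auto)
  next
    case True
    have "f ` B \<subseteq> B"
    proof (rule dichotomy[OF connectedin_continuous_map_image[OF cont B(2)] B(1) A(1)])
      show "f ` B \<subseteq> B \<union> A"
        using fpart part(1) True by blast
    qed (use part(2) s(1) sfB in auto)
    with BfB have fB: "f ` B = B" by simp
    have "topspace X - A = B \<union> C"
      unfolding part(1) using part(2,3) by blast
    moreover have "topspace X - f ` A = B \<union> f ` C"
      unfolding fpart using fAB fAC unfolding fB by blast
    moreover have "(B \<union> C) \<inter> (B \<union> f ` C) = B"
      using fC part(3) by blast
    ultimately have "B = (topspace X - A) \<inter> (topspace X - f ` A)"
      by simp
    moreover have "closedin X ((topspace X - A) \<inter> (topspace X - f ` A))"
      using A(1) opn[OF A(1)] by (intro closedin_Int closedin_diff closedin_topspace)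
    ultimately have "B = {} \<or> B = topspace X"
      using clopen[OF B(1)] by simp
    then have "A \<subseteq> B" using s(1) sub(1) by blast
    then show ?thesis using A(2) part(2) by blast
  qed
  show "B \<union> C \<subseteq> f ` B" using BfB CfB by blast
  show "f ` B \<inter> A \<noteq> {}"
  proof
    assume empty: "f ` B \<inter> A = {}"
    moreover have "f ` B \<subseteq> topspace X" using fpart by blast
    moreover have "topspace X - A = B \<union> C"
      unfolding part(1) using part(2,3) by blast
    ultimately have "f ` B = topspace X - A"
      using BfB CfB by blast
    moreover have "closedin X (topspace X - A)"
      using A(1) by (intro closedin_diff closedin_topspace)
    ultimately have "f ` B = {} \<or> f ` B = topspace X"
      using clopen[OF opn[OF B(1)]] by simp
    then show False
      using sfB A(2) sub(1) empty by blast
  qed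
qed

section \<open>Nondisplaceability\<close>

theorem mainTheorem2:
  fixes p q :: nat and C :: "(complex \<times> complex) set set"
  assumes "p \<ge> 2" and "q \<ge> 2" and "coprime p q"
    and "simple_closed_curve (spindle p q) C"
    and "C \<inter> singular_points (spindle p q) (spindle_atlas p q) = {}"
    and "card (connected_components_of
           (subtopology (spindle p q) (topspace (spindle p q) - C))) = 2"
    and "\<And>A. A \<in> connected_components_of
           (subtopology (spindle p q) (topspace (spindle p q) - C)) \<Longrightarrow>
           \<exists>!x. x \<in> A \<inter> singular_points (spindle p q) (spindle_atlas p q)"
  shows "\<not> (\<exists>f. orbifold_diffeomorphism (spindle p q) (spindle_atlas p q)
                  (spindle p q) (spindle_atlas p q) f \<and>
                area_preserving p q f \<and> f ` C \<inter> C = {})"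
proof
  interpret spindle_weights p q
    using assms(1-3) by unfold_locales
  assume "\<exists>f. orbifold_diffeomorphism X (spindle_atlas p q) X (spindle_atlas p q) f \<and>
    area_preserving p q f \<and> f ` C \<inter> C = {}"
  then obtain f where diffeo: "orbifold_diffeomorphism X (spindle_atlas p q) X (spindle_atlas p q) f"
    and area: "area_preserving p q f" and displaced: "f ` C \<inter> C = {}"
    by (elim exE conjE) (rule that)
  have f: "smooth_orbifold_map X (spindle_atlas p q) X (spindle_atlas p q) f"
    using diffeo by (simp add: orbifold_diffeomorphism_def)
  obtain g where g: "smooth_orbifold_map X (spindle_atlas p q) X (spindle_atlas p q) g"
    and inverse: "\<forall>x\<in>topspace X. g (f x) = x" "\<forall>x\<in>topspace X. f (g x) = x"
    using diffeo unfolding orbifold_diffeomorphism_def by (elim exE conjE) (rule that)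
  note gf = bspec[OF inverse(1)] and fg = bspec[OF inverse(2)]
  have cont: "continuous_map X X f" "continuous_map X X g"
    using f g by (simp_all add: smooth_orbifold_map_def)
  then have into: "f x \<in> topspace X" "g x \<in> topspace X" if "x \<in> topspace X" for x
    using that by (auto simp: continuous_map_def)
  have inj: "inj_on f (topspace X)"
    using gf by (rule inj_on_inverseI)
  have surj: "f ` topspace X = topspace X"
  proof (intro equalityI subsetI)
    fix y assume y: "y \<in> topspace X"
    from imageI[OF into(2)[OF y], of f] show "y \<in> f ` topspace X"
      unfolding fg[OF y] .
  qed (use into(1) in auto)
  have opn: "openin X (f ` U)" if U: "openin X U" for U
  proof -
    have UX: "U \<subseteq> topspace X" by (rule openin_subset[OF U])
    have "f ` U = {x \<in> topspace X. g x \<in> U}"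
    proof (intro equalityI subsetI)
      fix x assume "x \<in> {x \<in> topspace X. g x \<in> U}"
      then have x: "x \<in> topspace X" "g x \<in> U" by auto
      from imageI[OF x(2), of f] show "x \<in> f ` U"
        unfolding fg[OF x(1)] .
    next
      fix x assume "x \<in> f ` U"
      then obtain y where y: "y \<in> U" "x = f y" by blast
      moreover have "y \<in> topspace X" using UX y(1) by blast
      ultimately show "x \<in> {x \<in> topspace X. g x \<in> U}"
        using gf[of y] into(1)[of y] by simp
    qed
    then show ?thesis
      using openin_continuous_map_preimage[OF cont(2) U] by simp
  qed
  obtain c where c: "pathin X c" "C = c ` {0..1}"
    using assms(4) by (auto simp: simple_closed_curve_def)
  have C: "connectedin X C" "closedin X C"
    using connectedin_path_image[OF c(1)] compactin_path_image[OF c(1)]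
      compactin_imp_closedin[OF Hausdorff_spindle[OF cop p0 q0]] by (simp_all add: c(2))
  have CX: "C \<subseteq> topspace X" using closedin_subset[OF C(2)] .
  define Y where "Y = subtopology X (topspace X - C)"
  note comps = assms(6,7)[folded Y_def]
  have comp_props: "openin X A \<and> connectedin X A" if A: "A \<in> connected_components_of Y" for A
  proof -
    have "finite (connected_components_of Y)"
      using comps(1) card.infinite by fastforce
    then have "openin Y A"
      using A by (rule open_in_finite_connected_components)
    moreover have "openin X (topspace X - C)"
      using C(2) by (intro openin_diff openin_topspace)
    ultimately have "openin X A"
      unfolding Y_def using openin_open_subtopology by blast
    moreover have "connectedin X A"
      using connectedin_connected_components_of[OF A] unfolding Y_def connectedin_subtopology by blast
    ultimately show ?thesis ..
  qed
  obtain A\<^sub>1 A\<^sub>2 where comps12: "connected_components_of Y = {A\<^sub>1, A\<^sub>2}" "A\<^sub>1 \<noteq> A\<^sub>2"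
    using comps(1) unfolding card_2_iff by blast
  have disj: "A\<^sub>1 \<inter> A\<^sub>2 = {}"
    using pairwise_disjoint_connected_components_of[of Y] comps12
    by (auto simp: pairwise_def disjnt_def)
  have cover: "topspace X - C = A\<^sub>1 \<union> A\<^sub>2"
    using Union_connected_components_of[of Y] comps12(1) by (auto simp: Y_def)
  have pole: "pole_N \<in> A \<or> pole_S \<in> A" if "A \<in> connected_components_of Y" for A
    using comps(2)[OF that] singular_points_subset by blast
  have "pole_N \<in> A\<^sub>1 \<or> pole_S \<in> A\<^sub>1" "pole_N \<in> A\<^sub>2 \<or> pole_S \<in> A\<^sub>2"
    using pole comps12(1) by simp_all
  then have "(pole_N \<in> A\<^sub>1 \<and> pole_S \<in> A\<^sub>2) \<or> (pole_N \<in> A\<^sub>2 \<and> pole_S \<in> A\<^sub>1)"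
    using disj by blast
  then obtain A B where AB: "A \<in> connected_components_of Y" "B \<in> connected_components_of Y"
    "A \<inter> B = {}" "topspace X - C = A \<union> B" and poles: "pole_N \<in> A" "pole_S \<in> B"
  proof (elim disjE conjE)
    assume "pole_N \<in> A\<^sub>1" "pole_S \<in> A\<^sub>2"
    then show thesis
      by (intro that[of A\<^sub>1 A\<^sub>2] disj cover) (simp_all add: comps12(1))
  next
    assume "pole_N \<in> A\<^sub>2" "pole_S \<in> A\<^sub>1"
    then show thesis
      using disj cover by (intro that[of A\<^sub>2 A\<^sub>1]) (auto simp: comps12(1))
  qed
  have A: "openin X A" "connectedin X A" and B: "openin X B" "connectedin X B"
    using comp_props AB(1,2) by simp_all
  have part: "topspace X = A \<union> B \<union> C" "A \<inter> C = {}" "B \<inter> C = {}"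
    using AB(4) CX by auto
  note f_poles = area_preserving_fixes_poles[OF f area inj]
  note obstruction = area_obstruction[OF f area inj A(1) poles(1) B(1) AB(3) opn[OF B(1)]]
  have "connectedin X (f ` C)"
    by (rule connectedin_continuous_map_image[OF cont(1) C(1)])
  moreover have fC: "f ` C \<subseteq> A \<union> B"
    using into(1) CX displaced AB(4) by blast
  ultimately have "f ` C \<subseteq> A \<or> f ` C \<subseteq> B"
    using connectedinD[OF _ A(1) B(1), of "f ` C"] AB(3) by blast
  then show False
  proof
    assume "f ` C \<subseteq> A"
    have "A \<noteq> {}" using poles(1) by blast
    note K = displaced_separator_nested[OF connected_spindle opn cont(1) inj surj A(1) this B C(1)
        part(1) AB(3) part(2,3) poles(2) f_poles(2) \<open>f ` C \<subseteq> A\<close>]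
    have "B \<subseteq> f ` B" "f ` B \<inter> A \<subseteq> f ` B - B"
      using K(1) AB(3) by blast+
    moreover have "openin X (f ` B \<inter> A)"
      using opn[OF B(1)] A(1) by (rule openin_Int)
    ultimately show False
      using obstruction(1)[OF _ K(2)] by simp
  next
    assume "f ` C \<subseteq> B"
    have part': "topspace X = B \<union> A \<union> C" "B \<inter> A = {}"
      using part(1) AB(3) by auto
    have "B \<noteq> {}" using poles(2) by blast
    note K = displaced_separator_nested[OF connected_spindle opn cont(1) inj surj B(1) this A C(1)
        part' part(3,2) poles(1) f_poles(1) \<open>f ` C \<subseteq> B\<close>]
    have "f ` A \<inter> f ` B = f ` (A \<inter> B)"
      by (rule inj_on_image_Int[OF inj, symmetric]) (simp_all add: openin_subset A(1) B(1))
    then have disjoint: "f ` A \<inter> f ` B = {}"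
      by (simp add: AB(3))
    have "f ` B \<subseteq> A \<union> B \<union> C"
      using openin_subset[OF opn[OF B(1)]] by (simp only: part(1))
    with disjoint K(1) have "f ` B \<subseteq> B" by blast
    moreover from disjoint have "f ` A \<inter> B \<subseteq> B - f ` B" by blast
    moreover have "openin X (f ` A \<inter> B)"
      using opn[OF A(1)] B(1) by (rule openin_Int)
    ultimately show False
      using obstruction(2)[OF _ K(2)] by simp
  qed
qed

end
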